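(* Let $n,m,k$ be positive integers, let $X\in\mathbb{C}^{n\times n}$ be Hermitian, let $\Lambda:\mathbb{C}^{n\times n}\to\mathbb{C}^{m\times m}$ be a linear map and $Y\in\mathbb{C}^{m\times m}$. Let $\xi$ be the optimal value of \[ \max_{\rho\in\mathbb{C}^{n\times n}}\ \operatorname{Tr}(X\rho)\quad\text{s.t.}\quad \Lambda(\rho)=Y,\ \operatorname{Tr}(\rho)=1,\ \rho\ge 0,\ \operatorname{rank}(\rho)\le k . \] For a positive integer $N$, let $\mathcal{H}_A=\mathcal{H}_B=\cdots=\mathcal{H}_Z=\mathbb{C}^n\otimes\mathbb{C}^k$ be $N$ copies (parties $A,B,\dots,Z$), let $\widetilde{X}=X\otimes\mathbb{1}_k$, $\widetilde{\Lambda}(\cdot)=\Lambda[\operatorname{Tr}_2(\cdot)]$ with $\operatorname{Tr}_2$ the partial trace over $\mathbb{C}^k$, and let $\xi_N$ be the optimal value of the semidefinite program \[ \max_{\Phi_{AB\cdots Z}}\ \operatorname{Tr}\big[(\widetilde{X}_A\otimes\mathbb{1}_{B\cdots Z})\Phi_{AB\cdots Z}\big]\quad\text{s.t.}\quad \Phi_{AB\cdots Z}\ge0,\ \operatorname{Tr}(\Phi_{AB\cdots Z})=1,\ P_N^+\Phi_{AB\cdots Z}P_N^+=\Phi_{AB\cdots Z}, \] \[ (\widetilde{\Lambda}_A\otimes\mathrm{id}_{B\cdots Z})(\Phi_{AB\cdots Z})=Y\otimes\operatorname{Tr}_A(\Phi_{AB\cdots Z}). \] Then $\xi\le\xi_N$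 for every $N$, and moreover $\xi_{N+1}\le\xi_N$ for all $N$ and $\lim_{N\to+\infty}\xi_N=\xi$.
   Context: $\Phi_{AB\cdots Z}$ ranges over complex Hermitian operators on $\mathcal{H}_A\otimes\cdots\otimes\mathcal{H}_Z=(\mathbb{C}^n\otimes\mathbb{C}^k)^{\otimes N}$. $P_N^+=\frac{1}{N!}\sum_{\sigma\in S_N}V_\sigma$ is the orthogonal projector onto the symmetric subspace of $(\mathbb{C}^n\otimes\mathbb{C}^k)^{\otimes N}$, where $V_\sigma$ permutes the $N$ tensor factors according to $\sigma\in S_N$. A subscript $A$ indicates action on the first party; $\mathrm{id}_{B\cdots Z}$ is the identity map on operators of the remaining $N-1$ parties; $\operatorname{Tr}_A$ is the partial trace over the first party. *)

theory Defs
  imports "HOL-Analysis.Analysis" "HOL-Library.Extended_Real" "HOL-Combinatorics.Permutations"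
    "Jordan_Normal_Form.DL_Rank"
begin

definition mtrace :: "complex mat \<Rightarrow> complex" where
  "mtrace A = (\<Sum>i<dim_row A. A $$ (i,i))"

definition hermitian_mat :: "nat \<Rightarrow> complex mat \<Rightarrow> bool" where
  "hermitian_mat n A \<longleftrightarrow> A \<in> carrier_mat n n \<and> (\<forall>i<n. \<forall>j<n. A $$ (i,j) = cnj (A $$ (j,i)))"

definition psd_mat :: "nat \<Rightarrow> complex mat \<Rightarrow> bool" where
  "psd_mat n A \<longleftrightarrow> A \<in> carrier_mat n n \<and>
     (\<forall>v :: nat \<Rightarrow> complex. let q = (\<Sum>i<n. \<Sum>j<n. cnj (v i) * A $$ (i,j) * v j)
                              in q \<in> \<real> \<and> 0 \<le> Re q)"

definition mat_rank :: "nat \<Rightarrow> complex mat \<Rightarrow> nat" where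
  "mat_rank n A = vec_space.rank n A"

definition linear_map_mat :: "nat \<Rightarrow> nat \<Rightarrow> (complex mat \<Rightarrow> complex mat) \<Rightarrow> bool" where
  "linear_map_mat n m L \<longleftrightarrow>
     (\<forall>A \<in> carrier_mat n n. L A \<in> carrier_mat m m) \<and>
     (\<forall>A \<in> carrier_mat n n. \<forall>B \<in> carrier_mat n n. L (A + B) = L A + L B) \<and>
     (\<forall>A \<in> carrier_mat n n. \<forall>c. L (c \<cdot>\<^sub>m A) = c \<cdot>\<^sub>m L A)"

text \<open>Optimal value xi of the rank-constrained problem (ereal; Sup of the empty set is -infinity).\<close>
definition xi_opt :: "nat \<Rightarrow> nat \<Rightarrow> nat \<Rightarrow> complex mat \<Rightarrow> (complex mat \<Rightarrow> complex mat) \<Rightarrow> complex mat \<Rightarrow> ereal" where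
  "xi_opt n m k X L Y = Sup { ereal (Re (mtrace (X * \<rho>))) | \<rho>.
       \<rho> \<in> carrier_mat n n \<and> L \<rho> = Y \<and> mtrace \<rho> = 1 \<and> psd_mat n \<rho> \<and> mat_rank n \<rho> \<le> k }"

text \<open>A basis index of one party C^n \<otimes> C^k is a pair (i,a), i<n, a<k; a basis index of
  N parties is a list of N such pairs (first entry = party A). Operators are functions
  from pairs of multi-indices to complex numbers.\<close>

definition party_idx :: "nat \<Rightarrow> nat \<Rightarrow> (nat \<times> nat) set" where
  "party_idx n k = {(i,a). i < n \<and> a < k}"

definition multi_idx :: "nat \<Rightarrow> nat \<Rightarrow> nat \<Rightarrow> (nat \<times> nat) list set" where
  "multi_idx n k N = {xs. length xs = N \<and> set xs \<subseteq> party_idx n k}"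

type_synonym op = "(nat \<times> nat) list \<Rightarrow> (nat \<times> nat) list \<Rightarrow> complex"

definition op_trace :: "nat \<Rightarrow> nat \<Rightarrow> nat \<Rightarrow> op \<Rightarrow> complex" where
  "op_trace n k N \<Phi> = (\<Sum>xs\<in>multi_idx n k N. \<Phi> xs xs)"

definition op_psd :: "nat \<Rightarrow> nat \<Rightarrow> nat \<Rightarrow> op \<Rightarrow> bool" where
  "op_psd n k N \<Phi> \<longleftrightarrow>
     (\<forall>v :: (nat \<times> nat) list \<Rightarrow> complex.
        let q = (\<Sum>xs\<in>multi_idx n k N. \<Sum>ys\<in>multi_idx n k N. cnj (v xs) * \<Phi> xs ys * v ys)
        in q \<in> \<real> \<and> 0 \<le> Re q)"

definition op_mult :: "nat \<Rightarrow> nat \<Rightarrow> nat \<Rightarrow> op \<Rightarrow> op \<Rightarrow> op" where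
  "op_mult n k N A B = (\<lambda>xs ys. \<Sum>zs\<in>multi_idx n k N. A xs zs * B zs ys)"

definition perm_op :: "nat \<Rightarrow> (nat \<Rightarrow> nat) \<Rightarrow> op" where
  "perm_op N \<sigma> = (\<lambda>xs ys. if (\<forall>i<N. xs ! i = ys ! (\<sigma> i)) then 1 else 0)"

definition sym_proj :: "nat \<Rightarrow> op" where
  "sym_proj N = (\<lambda>xs ys. (\<Sum>\<sigma>\<in>{\<sigma>. \<sigma> permutes {..<N}}. perm_op N \<sigma> xs ys) / of_nat (fact N))"

text \<open>Tr[(X~_A \<otimes> 1) \<Phi>], with X~ = X \<otimes> 1_k.\<close>
definition obj_N :: "nat \<Rightarrow> nat \<Rightarrow> nat \<Rightarrow> complex mat \<Rightarrow> op \<Rightarrow> complex" where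
  "obj_N n k N X \<Phi> =
     (\<Sum>xs\<in>multi_idx n k (N - 1). \<Sum>i<n. \<Sum>j<n. \<Sum>a<k. X $$ (i,j) * \<Phi> ((j,a) # xs) ((i,a) # xs))"

definition ptrace_A :: "nat \<Rightarrow> nat \<Rightarrow> op \<Rightarrow> op" where
  "ptrace_A n k \<Phi> = (\<lambda>xs ys. \<Sum>x\<in>party_idx n k. \<Phi> (x # xs) (x # ys))"

definition ptrace_2 :: "nat \<Rightarrow> nat \<Rightarrow> ((nat \<times> nat) \<Rightarrow> (nat \<times> nat) \<Rightarrow> complex) \<Rightarrow> complex mat" where
  "ptrace_2 n k M = mat n n (\<lambda>(i,j). \<Sum>a<k. M (i,a) (j,a))"

text \<open>(Lambda~_A \<otimes> id)(\<Phi>) with Lambda~ = Lambda \<circ> Tr_2: entry at row (p, xs), column (q, ys),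
  p,q < m, xs,ys multi-indices of the remaining N-1 parties.\<close>
definition lift_map :: "nat \<Rightarrow> nat \<Rightarrow> (complex mat \<Rightarrow> complex mat) \<Rightarrow> op
                         \<Rightarrow> nat \<Rightarrow> (nat \<times> nat) list \<Rightarrow> nat \<Rightarrow> (nat \<times> nat) list \<Rightarrow> complex" where
  "lift_map n k L \<Phi> p xs q ys = L (ptrace_2 n k (\<lambda>x y. \<Phi> (x # xs) (y # ys))) $$ (p,q)"

definition feasible_N :: "nat \<Rightarrow> nat \<Rightarrow> nat \<Rightarrow> nat \<Rightarrow> (complex mat \<Rightarrow> complex mat) \<Rightarrow> complex mat \<Rightarrow> op \<Rightarrow> bool" where
  "feasible_N n m k N L Y \<Phi> \<longleftrightarrow>
     op_psd n k N \<Phi> \<and> op_trace n k N \<Phi> = 1 \<and>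
     (\<forall>xs\<in>multi_idx n k N. \<forall>ys\<in>multi_idx n k N.
        op_mult n k N (op_mult n k N (sym_proj N) \<Phi>) (sym_proj N) xs ys = \<Phi> xs ys) \<and>
     (\<forall>p<m. \<forall>q<m. \<forall>xs\<in>multi_idx n k (N - 1). \<forall>ys\<in>multi_idx n k (N - 1).
        lift_map n k L \<Phi> p xs q ys = Y $$ (p,q) * ptrace_A n k \<Phi> xs ys)"

text \<open>Optimal value xi_N of the N-party SDP. Only the entries of Phi on
  multi_idx n k N enter any of the constraints or the objective.\<close>
definition xi_N :: "nat \<Rightarrow> nat \<Rightarrow> nat \<Rightarrow> complex mat \<Rightarrow> (complex mat \<Rightarrow> complex mat) \<Rightarrow> complex mat \<Rightarrow> nat \<Rightarrow> ereal" where
  "xi_N n m k X L Y N = Sup { ereal (Re (obj_N n k N X \<Phi>)) | \<Phi>. feasible_N n m k N L Y \<Phi> }"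

end

theory Submission
  imports Defs
begin

text \<open>
  A state of rank at most k on C^n is the reduction of a pure state on C^n \<otimes> C^k, so the
  rank-constrained problem is an optimisation over pure states, and tensor powers of these are
  feasible for every level of the hierarchy.

  For the convergence, measure one party of a feasible N+1-party state. The remaining parties are
  left in a feasible N-party state for every outcome, and the one-party marginal is the average of
  the marginals of these conditional states. Add to the objective a small multiple of the squared
  Hilbert-Schmidt norm of the one-party marginal. By strict convexity, the spread of the conditional
  marginals of a maximiser is at most the decrease of the optimal value from level N to level N+1,
  which tends to 0. Hence for an informationally complete measurement the two-party marginals of
  near-maximisers accumulate at a product \<rho> \<otimes> \<rho>; being supported on the symmetric subspace, it
  forces \<rho> to be pure, and \<rho> inherits the linear constraint. This replaces the quantum de Finetti
  theorem and needs no integration over pure states.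
\<close>

section \<open>Positive semidefinite kernels and rank\<close>

text \<open>The linear objective alone says nothing about the spread of the conditional states. The
  squared norm is added because its convexity gap is exactly a variance, and it is cheap: it is
  nonnegative on all states and equals 1 on the pure limit, so only \<open>t\<close> is lost. Two
  features of the constraints carry the argument. The linear constraint is an operator identity on
  the remaining parties, not only a condition on the one-party marginal, so it survives a
  measurement on another party. The symmetric projector acts on both sides, so rows and columns may
  be permuted independently; mere permutation invariance would allow mixed product limits.
  Near-maximisers at different levels are unrelated to each other. Compactness is used only for
  their two-party marginals, whose dimension does not grow with N.\<close>

definition psd_on :: "'a set \<Rightarrow> ('a \<Rightarrow> 'a \<Rightarrow> complex) \<Rightarrow> bool" where
  "psd_on A f \<longleftrightarrow> (\<forall>v. (\<Sum>x\<in>A. \<Sum>y\<in>A. cnj (v x) * f x y * v y) \<in> \<real> \<and>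
     0 \<le> Re (\<Sum>x\<in>A. \<Sum>y\<in>A. cnj (v x) * f x y * v y))"

text \<open>One notion for kernels on an index set covers matrices and N-party operators, so each
  closure property is proved once.\<close>

lemma psd_mat_iff_psd_on: "psd_mat n A \<longleftrightarrow> A \<in> carrier_mat n n \<and> psd_on {..<n} (\<lambda>i j. A $$ (i,j))"
  by (simp add: psd_mat_def psd_on_def Let_def)

lemma op_psd_iff_psd_on: "op_psd n k N \<Phi> \<longleftrightarrow> psd_on (multi_idx n k N) \<Phi>"
  by (simp add: op_psd_def psd_on_def Let_def)

lemma psd_onD:
  assumes "psd_on A f"
  shows "(\<Sum>x\<in>A. \<Sum>y\<in>A. cnj (v x) * f x y * v y) \<in> \<real>"
    and "0 \<le> Re (\<Sum>x\<in>A. \<Sum>y\<in>A. cnj (v x) * f x y * v y)"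
  using assms by (auto simp: psd_on_def)

lemma psd_on_cong:
  assumes "\<And>x y. x \<in> A \<Longrightarrow> y \<in> A \<Longrightarrow> f x y = g x y"
  shows "psd_on A f \<longleftrightarrow> psd_on A g"
proof -
  have "(\<Sum>x\<in>A. \<Sum>y\<in>A. cnj (v x) * f x y * v y) = (\<Sum>x\<in>A. \<Sum>y\<in>A. cnj (v x) * g x y * v y)" for v
    by (intro sum.cong refl) (simp add: assms)
  then show ?thesis unfolding psd_on_def by (simp only:)
qed

text \<open>Congruence without a transforming matrix. Restriction, Schur complements and
  conditioning use it with an explicit \<open>w\<close>.\<close>

lemma psd_on_transfer:
  fixes f :: "'a \<Rightarrow> 'a \<Rightarrow> complex" and g :: "'b \<Rightarrow> 'b \<Rightarrow> complex"
  assumes "psd_on A f"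
    and "\<And>v. \<exists>w. (\<Sum>x\<in>B. \<Sum>y\<in>B. cnj (v x) * g x y * v y) = (\<Sum>x\<in>A. \<Sum>y\<in>A. cnj (w x) * f x y * w y)"
  shows "psd_on B g"
  unfolding psd_on_def
proof (intro allI conjI)
  fix v :: "'b \<Rightarrow> complex"
  obtain w where w: "(\<Sum>x\<in>B. \<Sum>y\<in>B. cnj (v x) * g x y * v y) = (\<Sum>x\<in>A. \<Sum>y\<in>A. cnj (w x) * f x y * w y)"
    using assms(2)[of v] by blast
  show "(\<Sum>x\<in>B. \<Sum>y\<in>B. cnj (v x) * g x y * v y) \<in> \<real>"
    "0 \<le> Re (\<Sum>x\<in>B. \<Sum>y\<in>B. cnj (v x) * g x y * v y)"
    unfolding w by (rule psd_onD[OF assms(1)])+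
qed

lemma psd_on_sum:
  fixes f :: "'s \<Rightarrow> 'a \<Rightarrow> 'a \<Rightarrow> complex"
  assumes "\<And>s. s \<in> S \<Longrightarrow> psd_on A (f s)"
  shows "psd_on A (\<lambda>x y. \<Sum>s\<in>S. f s x y)"
proof -
  define Q where "Q s v = (\<Sum>x\<in>A. \<Sum>y\<in>A. cnj (v x) * f s x y * v y)" for s and v :: "'a \<Rightarrow> complex"
  have "(\<Sum>x\<in>A. \<Sum>y\<in>A. cnj (v x) * (\<Sum>s\<in>S. f s x y) * v y) = (\<Sum>s\<in>S. Q s v)" for v
    by (simp add: Q_def sum_distrib_left sum_distrib_right sum.swap[where A = S])
  moreover have "Q s v \<in> \<real>" "0 \<le> Re (Q s v)" if "s \<in> S" for s v
    using psd_onD[OF assms[OF that]] unfolding Q_def by blast+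
  ultimately show ?thesis
    unfolding psd_on_def by (auto intro!: sum_in_Reals sum_nonneg)
qed

lemma psd_on_scale:
  fixes f :: "'a \<Rightarrow> 'a \<Rightarrow> complex"
  assumes "psd_on A f" "0 \<le> c"
  shows "psd_on A (\<lambda>x y. complex_of_real c * f x y)"
proof -
  have "(\<Sum>x\<in>A. \<Sum>y\<in>A. cnj (v x) * (complex_of_real c * f x y) * v y)
      = complex_of_real c * (\<Sum>x\<in>A. \<Sum>y\<in>A. cnj (v x) * f x y * v y)" for v :: "'a \<Rightarrow> complex"
    by (simp add: sum_distrib_left mult_ac)
  then show ?thesis
    using psd_onD[OF assms(1)] assms(2) unfolding psd_on_def by (auto intro!: Reals_mult)
qed

text \<open>Test vectors are extended by zero outside the image of \<open>g\<close>; injectivity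
  makes the extension well defined.\<close>

lemma psd_on_reindex:
  fixes f :: "'a \<Rightarrow> 'a \<Rightarrow> complex" and g :: "'b \<Rightarrow> 'a"
  assumes "psd_on A f" "finite A" "inj_on g B" "g ` B \<subseteq> A"
  shows "psd_on B (\<lambda>x y. f (g x) (g y))"
proof -
  have "\<exists>w. (\<Sum>x\<in>B. \<Sum>y\<in>B. cnj (v x) * f (g x) (g y) * v y)
       = (\<Sum>x\<in>A. \<Sum>y\<in>A. cnj (w x) * f x y * w y)" for v :: "'b \<Rightarrow> complex"
  proof
    let ?w = "\<lambda>x. if x \<in> g ` B then v (the_inv_into B g x) else 0"
    \<comment> \<open>Zero entries contribute nothing, so the sum restricts to the image. It is
      applied to columns first, then to rows.\<close>
    have *: "(\<Sum>x\<in>A. G x (?w x)) = (\<Sum>x\<in>B. G (g x) (v x))"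
      if "\<And>x. G x 0 = 0" for G :: "'a \<Rightarrow> complex \<Rightarrow> complex"
    proof -
      have "(\<Sum>x\<in>A. G x (?w x)) = (\<Sum>x\<in>g ` B. G x (?w x))"
        by (rule sum.mono_neutral_right) (use assms that in auto)
      also have "\<dots> = (\<Sum>x\<in>B. G (g x) (?w (g x)))"
        by (simp add: sum.reindex[OF assms(3)] o_def)
      also have "\<dots> = (\<Sum>x\<in>B. G (g x) (v x))"
        by (rule sum.cong) (simp_all add: the_inv_into_f_f[OF assms(3)])
      finally show ?thesis .
    qed
    have "(\<Sum>x\<in>A. \<Sum>y\<in>A. cnj (?w x) * f x y * ?w y) = (\<Sum>x\<in>A. \<Sum>y\<in>B. cnj (?w x) * f x (g y) * v y)"
      using *[of "\<lambda>y c. cnj (?w x) * f x y * c" for x] by simp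
    also have "\<dots> = (\<Sum>x\<in>B. \<Sum>y\<in>B. cnj (v x) * f (g x) (g y) * v y)"
      using *[of "\<lambda>x c. \<Sum>y\<in>B. cnj c * f x (g y) * v y"] by simp
    finally show "(\<Sum>x\<in>B. \<Sum>y\<in>B. cnj (v x) * f (g x) (g y) * v y)
       = (\<Sum>x\<in>A. \<Sum>y\<in>A. cnj (?w x) * f x y * ?w y)" by simp
  qed
  then show ?thesis by (rule psd_on_transfer[OF assms(1)])
qed

text \<open>The test vector is 1 at \<open>x\<close> and \<open>c\<close> at \<open>y\<close>; the
  free \<open>c\<close> will be 1, the imaginary unit, or a phase adapted to the entry.\<close>

lemma psd_on_2:
  assumes "psd_on A f" "finite A" "x \<in> A" "y \<in> A" "x \<noteq> y"
  shows "f x x + cnj c * f y x + f x y * c + cnj c * f y y * c \<in> \<real>"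
    and "0 \<le> Re (f x x + cnj c * f y x + f x y * c + cnj c * f y y * c)"
proof -
  let ?v = "\<lambda>z. if z = y then c else 1"
  have "psd_on {x,y} f"
    using psd_on_reindex[OF assms(1,2), of id "{x,y}"] assms by simp
  from psd_onD[OF this, of ?v] assms(5)
  show "f x x + cnj c * f y x + f x y * c + cnj c * f y y * c \<in> \<real>"
    and "0 \<le> Re (f x x + cnj c * f y x + f x y * c + cnj c * f y y * c)"
    by (simp_all add: algebra_simps)
qed

lemma psd_on_diag:
  assumes "psd_on A f" "finite A" "x \<in> A"
  shows "f x x \<in> \<real>" "0 \<le> Re (f x x)"
proof -
  have "psd_on {x} f"
    using psd_on_reindex[OF assms(1,2), of id "{x}"] assms by simp
  from psd_onD[OF this, of "\<lambda>_. 1"] show "f x x \<in> \<real>" "0 \<le> Re (f x x)" by simp_all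
qed

lemma psd_on_hermitian:
  assumes "psd_on A f" "finite A" "x \<in> A" "y \<in> A"
  shows "f y x = cnj (f x y)"
proof (cases "x = y")
  case True
  then show ?thesis using psd_on_diag(1)[OF assms(1-3)] by (simp add: Reals_cnj_iff)
next
  case False
  have d: "Im (f x x) = 0" "Im (f y y) = 0"
    using psd_on_diag(1)[OF assms(1,2)] assms(3,4) by (auto simp: complex_is_Real_iff)
  \<comment> \<open>Realness at \<open>c = 1\<close> makes the imaginary parts opposite; at
    \<open>c = \<i>\<close> it makes the real parts equal.\<close>
  show ?thesis
    using psd_on_2(1)[OF assms False, of 1] psd_on_2(1)[OF assms False, of \<i>] d
    by (auto simp: complex_is_Real_iff complex_eq_iff)
qed

lemma psd_on_norm_le:
  assumes "psd_on A f" "finite A" "x \<in> A" "y \<in> A"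
  shows "2 * cmod (f x y) \<le> Re (f x x) + Re (f y y)"
proof (cases "x = y")
  case True
  then show ?thesis using psd_on_diag[OF assms(1-3)] 
    by (auto simp: complex_is_Real_iff cmod_def)
next
  case False
  \<comment> \<open>This phase turns both cross terms into minus the modulus. As
    \<open>sgn 0 = 0\<close>, its modulus is at most 1 in all cases, which suffices because
    \<open>f y y\<close> is nonnegative.\<close>
  let ?c = "- cnj (sgn (f x y))"
  have h: "f y x = cnj (f x y)" by (rule psd_on_hermitian[OF assms])
  have e: "f x y * ?c = - complex_of_real (cmod (f x y))"
    by (cases "f x y = 0") (auto simp: sgn_div_norm scaleR_conv_of_real complex_norm_square[symmetric] power2_eq_square field_simps)
  have e2: "cnj ?c * f y x = - complex_of_real (cmod (f x y))"
    using arg_cong[OF e, of cnj] by (simp add: h mult.commute)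
  have "cnj ?c * f y y * ?c = complex_of_real ((cmod (sgn (f x y)))\<^sup>2) * f y y"
    by (simp only: complex_norm_square) (simp add: mult_ac)
  also have "Re \<dots> \<le> Re (f y y)"
    using psd_on_diag(2)[OF assms(1,2,4)] by (simp add: norm_sgn)
  finally have "Re (cnj ?c * f y y * ?c) \<le> Re (f y y)" .
  with psd_on_2(2)[OF assms False, of ?c] show ?thesis
    unfolding e e2 by simp
qed

lemma psd_on_trace_nonneg:
  assumes "psd_on A f" "finite A"
  shows "(\<Sum>x\<in>A. f x x) = complex_of_real (Re (\<Sum>x\<in>A. f x x))" "0 \<le> Re (\<Sum>x\<in>A. f x x)"
  using psd_on_diag[OF assms] by (auto intro!: sum_nonneg sum_in_Reals simp: of_real_Re)

text \<open>Gives compactness of normalised states, and shows that a measurement outcome of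
  probability zero leaves the zero operator.\<close>

lemma psd_on_norm_le_trace:
  assumes "psd_on A f" "finite A" "x \<in> A" "y \<in> A"
  shows "cmod (f x y) \<le> Re (\<Sum>x\<in>A. f x x)"
proof -
  have "Re (f z z) \<le> Re (\<Sum>x\<in>A. f x x)" if "z \<in> A" for z
    using member_le_sum[of z A "\<lambda>x. Re (f x x)"] psd_on_diag[OF assms(1,2)] assms(2) that by simp
  from this[OF assms(3)] this[OF assms(4)] psd_on_norm_le[OF assms] show ?thesis by simp
qed

lemma psd_on_deflate:
  fixes f :: "'a \<Rightarrow> 'a \<Rightarrow> complex"
  assumes "psd_on A f" "finite A" "l \<in> A" "f l l \<noteq> 0"
  shows "psd_on A (\<lambda>x y. f x y - f x l * f l y / f l l)"
proof -
  have "\<exists>w. (\<Sum>x\<in>A. \<Sum>y\<in>A. cnj (v x) * (f x y - f x l * f l y / f l l) * v y)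
       = (\<Sum>x\<in>A. \<Sum>y\<in>A. cnj (w x) * f x y * w y)" for v :: "'a \<Rightarrow> complex"
  proof
    \<comment> \<open>Completing the square: the entry at \<open>l\<close> is shifted by
      \<open>s\<close> so that row \<open>l\<close> of \<open>f\<close> annihilates the new
      vector.\<close>
    define s where "s = (\<Sum>y\<in>A. f l y * v y) / f l l"
    let ?w = "\<lambda>x. v x - (if x = l then s else 0)"
    have row: "(\<Sum>y\<in>A. f x y * ?w y) = (\<Sum>y\<in>A. f x y * v y) - f x l * s" for x
      using assms(2,3) by (simp add: right_diff_distrib sum_subtractf if_distrib[of "\<lambda>z. _ * z"] sum.delta cong: if_cong)
    have row0: "(\<Sum>y\<in>A. f l y * ?w y) = 0"
      unfolding row using assms(4) by (simp add: s_def)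
    have "(\<Sum>x\<in>A. \<Sum>y\<in>A. cnj (?w x) * f x y * ?w y) = (\<Sum>x\<in>A. cnj (?w x) * (\<Sum>y\<in>A. f x y * ?w y))"
      by (simp add: sum_distrib_left mult.assoc)
    also have "\<dots> = (\<Sum>x\<in>A. cnj (v x) * (\<Sum>y\<in>A. f x y * ?w y) - (if x = l then cnj s * (\<Sum>y\<in>A. f x y * ?w y) else 0))"
      by (rule sum.cong) (auto simp: algebra_simps)
    also have "\<dots> = (\<Sum>x\<in>A. cnj (v x) * (\<Sum>y\<in>A. f x y * ?w y))"
      using assms(2,3) row0 by (simp add: sum_subtractf sum.delta')
    also have "\<dots> = (\<Sum>x\<in>A. \<Sum>y\<in>A. cnj (v x) * (f x y - f x l * f l y / f l l) * v y)"
      unfolding row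
      by (simp add: s_def sum_distrib_left sum_subtractf algebra_simps sum_divide_distrib)
    finally show "(\<Sum>x\<in>A. \<Sum>y\<in>A. cnj (v x) * (f x y - f x l * f l y / f l l) * v y) = 
      (\<Sum>x\<in>A. \<Sum>y\<in>A. cnj (?w x) * f x y * ?w y)" by simp
  qed
  then show ?thesis by (rule psd_on_transfer[OF assms(1)])
qed

text \<open>Each Schur complement through a positive diagonal entry lowers the number of summands by one.\<close>

lemma psd_on_gram:
  assumes "finite S" "finite A" "psd_on A f"
    and "\<And>x y. x \<in> A \<Longrightarrow> y \<in> A \<Longrightarrow> f x y = (\<Sum>s\<in>S. c s x * d s y)"
  shows "\<exists>b. \<forall>x\<in>A. \<forall>y\<in>A. f x y = (\<Sum>s\<in>S. b s x * cnj (b s y))"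
  using assms
proof (induction "card S" arbitrary: S f c d)
  case 0
  then show ?case by auto
next
  case (Suc r)
  show ?case
  proof (cases "\<forall>x\<in>A. f x x = 0")
    case True
    have "f x y = 0" if "x \<in> A" "y \<in> A" for x y
      using psd_on_norm_le[OF Suc.prems(3,2) that] True that by simp
    then show ?thesis by (intro exI[of _ "\<lambda>_ _. 0"]) simp
  next
    case False
    then obtain l where l: "l \<in> A" "f l l \<noteq> 0" by auto
    let ?g = "\<lambda>x y. f x y - f x l * f l y / f l l"
    obtain s0 where s0: "s0 \<in> S" "c s0 l \<noteq> 0"
      using l Suc.prems(4)[OF l(1) l(1)] by (metis (no_types, lifting) mult_eq_0_iff sum.neutral)
    define S' where "S' = S - {s0}"
    have S: "S = insert s0 S'" "s0 \<notin> S'" "finite S'" "card S' = r"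
      using s0 Suc.hyps(2) Suc.prems(1) by (auto simp: S'_def)
    define c' where "c' s x = c s x - c s0 x * c s l / c s0 l" for s x
    define d' where "d' s y = d s y - d s l * f l y / f l l" for s y
    have "psd_on A ?g" by (rule psd_on_deflate[OF Suc.prems(3,2) l])
    moreover have "?g x y = (\<Sum>s\<in>S'. c' s x * d' s y)" if xy: "x \<in> A" "y \<in> A" for x y
    proof -
      have *: "?g z y = (\<Sum>s\<in>S. c s z * d' s y)" if "z \<in> A" for z
        using Suc.prems(4)[OF that xy(2)] Suc.prems(4)[OF that l(1)]
        by (simp add: d'_def algebra_simps sum_subtractf sum_distrib_left sum_divide_distrib)
      \<comment> \<open>Row \<open>l\<close> of the Schur complement vanishes. This is a linear
        relation with nonzero coefficient at \<open>s0\<close>, so that summand can be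
        eliminated.\<close>
      have "0 = (\<Sum>s\<in>S. c s l * d' s y)" using *[OF l(1)] l(2) by simp
      then have "c s0 l * d' s0 y = - (\<Sum>s\<in>S'. c s l * d' s y)"
        using S by (simp add: eq_neg_iff_add_eq_0)
      then have "d' s0 y = - (\<Sum>s\<in>S'. c s l * d' s y) / c s0 l"
        using s0(2) by (simp add: field_simps)
      then have "?g x y = (\<Sum>s\<in>S'. c s x * d' s y) - c s0 x * (\<Sum>s\<in>S'. c s l * d' s y) / c s0 l"
        using *[OF xy(1)] S by simp
      then show ?thesis
        by (simp add: c'_def algebra_simps sum_subtractf sum_distrib_left sum_divide_distrib)
    qed
    ultimately obtain b where b: "\<And>x y. x \<in> A \<Longrightarrow> y \<in> A \<Longrightarrow> ?g x y = (\<Sum>s\<in>S'. b s x * cnj (b s y))"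
      using Suc.hyps(1)[OF S(4)[symmetric] S(3) Suc.prems(2), of ?g c' d'] by blast
    \<comment> \<open>The removed rank-one piece is \<open>b0\<close> times its conjugate; it fills
      the slot freed by \<open>s0\<close>.\<close>
    define b0 where "b0 x = f x l / complex_of_real (sqrt (Re (f l l)))" for x
    have fl: "f l l = complex_of_real (Re (f l l))" "Re (f l l) > 0"
      using psd_on_diag[OF Suc.prems(3,2) l(1)] l(2) 
      by (auto simp: complex_is_Real_iff complex_eq_iff less_le)
    have b0: "b0 x * cnj (b0 y) = f x l * f l y / f l l" if "x \<in> A" "y \<in> A" for x y
    proof -
      have "complex_of_real (sqrt (Re (f l l))) * complex_of_real (sqrt (Re (f l l))) = f l l"
        unfolding of_real_mult[symmetric] using fl by simp
      then show ?thesis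
        using psd_on_hermitian[OF Suc.prems(3,2) that(2) l(1)] by (simp add: b0_def)
    qed
    have "f x y = (\<Sum>s\<in>S. (b(s0 := b0)) s x * cnj ((b(s0 := b0)) s y))" if "x \<in> A" "y \<in> A" for x y
    proof -
      have "(\<Sum>s\<in>S'. (b(s0 := b0)) s x * cnj ((b(s0 := b0)) s y)) = (\<Sum>s\<in>S'. b s x * cnj (b s y))"
        by (rule sum.cong) (use S in auto)
      then show ?thesis using S b[OF that] b0[OF that] by (simp add: diff_eq_eq add.commute)
    qed
    then show ?thesis by blast
  qed
qed

section \<open>Rank as the number of product terms\<close>

lemma mat_rank_factorization:
  assumes A: "A \<in> carrier_mat n nc" and r: "mat_rank n A \<le> k"
  shows "\<exists>c d. \<forall>i<n. \<forall>j<nc. A $$ (i,j) = (\<Sum>s<k. c s i * d s j)"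
proof -
  interpret vec_space "TYPE(complex)" n .
  let ?P = "\<lambda>T. T \<subseteq> set (cols A) \<and> lin_indpt T"
  have "lin_indpt {}" by (simp add: lin_dep_def)
  \<comment> \<open>The cardinality of a maximal independent set of columns is the rank, and by
    maximality every column lies in its span.\<close>
  then obtain S where S: "finite S" "maximal S ?P"
    using maximal_exists_superset[of "set (cols A)" ?P "{}"] by auto
  have cc: "set (cols A) \<subseteq> carrier_vec n" using A cols_dim by blast
  have SS: "S \<subseteq> set (cols A)" "lin_indpt S" using S(2) by (auto simp: maximal_def)
  have Sc: "S \<subseteq> carrier_vec n" using SS cc by auto
  have card: "card S \<le> k" using rank_card_indpt[OF A S(2)] r by (simp add: mat_rank_def)
  have "\<exists>a. \<forall>i<n. A $$ (i,j) = (\<Sum>v\<in>S. a v * v $ i)" if j: "j < nc" for j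
  proof -
    have cj: "col A j \<in> set (cols A)" using j A by (auto simp: cols_def)
    have cs: "col A j \<in> span S"
    proof (rule ccontr)
      assume n: "col A j \<notin> span S"
      have "col A j \<notin> S" using n in_own_span[of S] Sc by auto
      then have "lin_indpt (insert (col A j) S)"
        using lin_dep_iff_in_span[of S "col A j"] n cj cc Sc SS by auto
      then have "?P (insert (col A j) S)" using SS cj by auto
      then have "insert (col A j) S = S" using S(2) unfolding maximal_def by blast
      then have "col A j \<in> S" by blast
      then show False using n in_own_span[of S] Sc by auto
    qed
    obtain a where a: "lincomb a S = col A j"
      using finite_in_span[OF S(1) _ cs] Sc by auto
    have "A $$ (i,j) = (\<Sum>v\<in>S. a v * v $ i)" if "i < n" for i
      using lincomb_index[OF that Sc, of a] that j A unfolding a by simp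
    then show ?thesis by blast
  qed
  then obtain a where a: "\<And>i j. i < n \<Longrightarrow> j < nc \<Longrightarrow> A $$ (i,j) = (\<Sum>v\<in>S. a j v * v $ i)" by metis
  obtain e where e: "bij_betw e S {..<card S}"
    using ex_bij_betw_finite_nat[OF S(1)] by (auto simp: atLeast0LessThan)
  let ?e = "the_inv_into S e"
  \<comment> \<open>The enumeration of \<open>S\<close> is padded with zero vectors to exactly
    \<open>k\<close> terms.\<close>
  have *: "A $$ (i,j) = (\<Sum>s<k. (if s < card S then ?e s $ i else 0) * a j (?e s))" if "i < n" "j < nc" for i j
  proof -
    have "(\<Sum>s<k. (if s < card S then ?e s $ i else 0) * a j (?e s)) = (\<Sum>s<card S. ?e s $ i * a j (?e s))"
      by (rule sum.mono_neutral_cong_right) (use card in auto)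
    also have "\<dots> = (\<Sum>v\<in>S. v $ i * a j v)"
      by (rule sum.reindex_bij_betw[OF bij_betw_the_inv_into[OF e]])
    finally show ?thesis using a[OF that] by (simp add: mult.commute)
  qed
  show ?thesis
    by (intro exI[of _ "\<lambda>s i. if s < card S then ?e s $ i else 0"] exI[of _ "\<lambda>s j. a j (?e s)"] allI impI, rule *)
qed

text \<open>Each product term has rank at most one, and rank is subadditive.\<close>

lemma mat_rank_sum_le:
  "mat_rank n (mat n nc (\<lambda>(i,j). \<Sum>s<k. c s i * d s j)) \<le> k"
proof (induction k)
  case 0
  have "mat n nc (\<lambda>(i,j). \<Sum>s<0::nat. c s i * d s j) = 0\<^sub>m n nc" by (rule eq_matI) auto
  then show ?case using vec_space.rank_0I[of n nc] by (simp only: mat_rank_def le_zero_eq)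
next
  case (Suc k)
  let ?A = "mat n nc (\<lambda>(i,j). \<Sum>s<k. c s i * d s j)" and ?B = "mat n nc (\<lambda>(i,j). c k i * d k j)"
  have "mat n nc (\<lambda>(i,j). \<Sum>s<Suc k. c s i * d s j) = ?A + ?B" by (rule eq_matI) auto
  moreover have "vec_space.rank n (?A + ?B) \<le> vec_space.rank n ?A + vec_space.rank n ?B"
    by (rule vec_space.rank_subadditive) auto
  moreover have "vec_space.rank n ?B \<le> 1"
    by (rule vec_space.rank_le_1_product_entries[where f = "c k" and g = "d k" and nc = nc]) auto
  ultimately show ?case using Suc.IH by (simp add: mat_rank_def)
qed

text \<open>A rank factorisation has unrelated factors; positivity replaces them by vectors and
  their conjugates with the same number of terms, without diagonalisation. That number becomes the
  dimension of the ancilla.\<close>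

lemma psd_rank_gram:
  assumes "psd_mat n \<rho>" "mat_rank n \<rho> \<le> k"
  shows "\<exists>b. \<forall>i<n. \<forall>j<n. \<rho> $$ (i,j) = (\<Sum>s<k. b s i * cnj (b s j))"
proof -
  have \<rho>: "\<rho> \<in> carrier_mat n n" "psd_on {..<n} (\<lambda>i j. \<rho> $$ (i,j))"
    using assms(1) by (auto simp: psd_mat_iff_psd_on)
  obtain c d where "\<forall>i<n. \<forall>j<n. \<rho> $$ (i,j) = (\<Sum>s<k. c s i * d s j)"
    using mat_rank_factorization[OF \<rho>(1) assms(2)] by blast
  then show ?thesis
    using psd_on_gram[where S = "{..<k}" and c = c and d = d, OF _ _ \<rho>(2)] by auto
qed

lemma psd_on_outer:
  fixes w :: "'a \<Rightarrow> complex"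
  shows
  "psd_on A (\<lambda>x y. w x * cnj (w y))"
proof -
  have "(\<Sum>x\<in>A. \<Sum>y\<in>A. cnj (v x) * (w x * cnj (w y)) * v y)
     = complex_of_real ((cmod (\<Sum>x\<in>A. cnj (v x) * w x))\<^sup>2)" for v :: "'a \<Rightarrow> complex"
    unfolding complex_norm_square cnj_sum sum_product by (simp add: mult_ac)
  then show ?thesis unfolding psd_on_def by (simp del: of_real_power)
qed

section \<open>Symmetric operators on words\<close>

text \<open>Over an arbitrary alphabet: the split of a party into C^n and C^k enters only in the
  final translation.\<close>

definition words :: "'a set \<Rightarrow> nat \<Rightarrow> 'a list set" where
  "words D N = {xs. length xs = N \<and> set xs \<subseteq> D}"

lemma multi_idx_eq_words: "multi_idx n k N = words (party_idx n k) N"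
  by (simp add: multi_idx_def words_def)

lemma finite_words [simp]: "finite D \<Longrightarrow> finite (words D N)"
  using finite_lists_length_eq[of D N] by (simp add: words_def conj_commute)

lemma words_0 [simp]: "words D 0 = {[]}"
  by (auto simp: words_def)

lemma Cons_in_words [simp]: "x # xs \<in> words D (Suc N) \<longleftrightarrow> x \<in> D \<and> xs \<in> words D N"
  by (auto simp: words_def)

lemma words_mset: "xs \<in> words D N \<Longrightarrow> mset ys = mset xs \<Longrightarrow> ys \<in> words D N"
  by (metis (mono_tags, lifting) mem_Collect_eq mset_eq_setD size_mset words_def)

lemma sum_words_Suc:
  "(\<Sum>xs\<in>words D (Suc N). f xs) = (\<Sum>x\<in>D. \<Sum>xs\<in>words D N. f (x # xs))"
proof -
  have "bij_betw (\<lambda>(x, xs). x # xs) (D \<times> words D N) (words D (Suc N))"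
    unfolding bij_betw_def by (auto simp: inj_on_def image_def words_def length_Suc_conv)
  from sum.reindex_bij_betw[OF this, of f] show ?thesis
    by (simp add: sum.cartesian_product case_prod_unfold)
qed

lemma sum_words_prod_list:
  fixes f :: "'a \<Rightarrow> 'b::comm_semiring_1"
  shows "(\<Sum>xs\<in>words D N. prod_list (map f xs)) = (\<Sum>x\<in>D. f x) ^ N"
proof (induction N)
  case (Suc N)
  have "(\<Sum>xs\<in>words D (Suc N). prod_list (map f xs)) = (\<Sum>x\<in>D. f x * (\<Sum>xs\<in>words D N. prod_list (map f xs)))"
    by (simp add: sum_words_Suc sum_distrib_left)
  then show ?case by (simp add: Suc.IH sum_distrib_right)
qed simp

text \<open>Rows and columns are rearranged independently. This expresses support on the symmetric
  subspace and is stronger than invariance under simultaneous permutations.\<close>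

definition word_sym :: "'a set \<Rightarrow> nat \<Rightarrow> ('a list \<Rightarrow> 'a list \<Rightarrow> complex) \<Rightarrow> bool" where
  "word_sym D N \<Phi> \<longleftrightarrow> (\<forall>xs\<in>words D N. \<forall>ys\<in>words D N. \<forall>xs' ys'.
     mset xs' = mset xs \<longrightarrow> mset ys' = mset ys \<longrightarrow> \<Phi> xs' ys' = \<Phi> xs ys)"

lemma word_symD:
  assumes "word_sym D N \<Phi>" "xs \<in> words D N" "ys \<in> words D N" "mset xs' = mset xs" "mset ys' = mset ys"
  shows "\<Phi> xs' ys' = \<Phi> xs ys"
  using assms unfolding word_sym_def by blast

section \<open>Permutation operators and the symmetric projector\<close>

lemma permute_list_inv:
  assumes "\<sigma> permutes {..<length xs}"
  shows "permute_list (inv_into UNIV \<sigma>) (permute_list \<sigma> xs) = xs"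
    and "permute_list \<sigma> (permute_list (inv_into UNIV \<sigma>) xs) = xs"
proof -
  show "permute_list (inv_into UNIV \<sigma>) (permute_list \<sigma> xs) = xs"
    unfolding permute_list_compose[OF permutes_inv[OF assms], of \<sigma>, symmetric] permutes_inv_o[OF assms]
    by (rule permute_list_id)
  show "permute_list \<sigma> (permute_list (inv_into UNIV \<sigma>) xs) = xs"
    unfolding permute_list_compose[OF assms, of "inv_into UNIV \<sigma>", symmetric] permutes_inv_o[OF assms]
    by (rule permute_list_id)
qed

lemma permute_list_eq_iff:
  assumes "\<sigma> permutes {..<length xs}" "length ys = length xs"
  shows "permute_list \<sigma> xs = permute_list \<sigma> ys \<longleftrightarrow> xs = ys"
  using permute_list_inv(1)[OF assms(1)] permute_list_inv(1)[of \<sigma> ys] assms by metis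

lemma perm_op_permute_list:
  assumes "\<sigma> permutes {..<N}" "length xs = N" "length ys = N"
  shows "perm_op N \<sigma> xs ys = (if xs = permute_list \<sigma> ys then 1 else 0)"
  using assms by (auto simp: perm_op_def list_eq_iff_nth_eq permute_list_nth)

text \<open>The average over the group absorbs the rearranging permutation by composition.\<close>

lemma sym_proj_permute_left:
  assumes "mset xs' = mset xs" "length xs = N" "length ys = N"
  shows "sym_proj N xs' ys = sym_proj N xs ys"
proof -
  obtain \<tau> where \<tau>: "\<tau> permutes {..<N}" "permute_list \<tau> xs = xs'"
    using mset_eq_permutation[OF assms(1)] assms(2) by metis
  have l: "length xs' = N" using \<tau>(2) assms(2) by auto
  have "(\<Sum>\<sigma>\<in>{\<sigma>. \<sigma> permutes {..<N}}. perm_op N \<sigma> xs' ys)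
      = (\<Sum>\<sigma>\<in>{\<sigma>. \<sigma> permutes {..<N}}. perm_op N (\<sigma> \<circ> \<tau>) xs' ys)"
    by (rule sum_permutations_compose_right[OF \<tau>(1)])
  also have "\<dots> = (\<Sum>\<sigma>\<in>{\<sigma>. \<sigma> permutes {..<N}}. perm_op N \<sigma> xs ys)"
  proof (rule sum.cong[OF refl])
    fix \<sigma> assume "\<sigma> \<in> {\<sigma>. \<sigma> permutes {..<N}}"
    then have \<sigma>: "\<sigma> permutes {..<N}" by simp
    have "permute_list (\<sigma> \<circ> \<tau>) ys = permute_list \<tau> (permute_list \<sigma> ys)"
      using permute_list_compose[of \<tau> ys \<sigma>] \<tau>(1) \<sigma> assms by simp
    then show "perm_op N (\<sigma> \<circ> \<tau>) xs' ys = perm_op N \<sigma> xs ys"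
      using perm_op_permute_list[OF permutes_compose[OF \<tau>(1) \<sigma>] l assms(3)]
        perm_op_permute_list[OF \<sigma> assms(2,3)] permute_list_eq_iff[of \<tau> xs "permute_list \<sigma> ys"] \<tau> assms
      by simp
  qed
  finally show ?thesis by (simp add: sym_proj_def)
qed

text \<open>Transposing a permutation matrix inverts the permutation, and the average runs over the
  whole group.\<close>

lemma sym_proj_commute:
  assumes "length xs = N" "length ys = N"
  shows "sym_proj N xs ys = sym_proj N ys xs"
proof -
  have "(\<Sum>\<sigma>\<in>{\<sigma>. \<sigma> permutes {..<N}}. perm_op N \<sigma> xs ys)
      = (\<Sum>\<sigma>\<in>{\<sigma>. \<sigma> permutes {..<N}}. perm_op N (inv_into UNIV \<sigma>) xs ys)"
    by (rule sum_permutations_inverse)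
  also have "\<dots> = (\<Sum>\<sigma>\<in>{\<sigma>. \<sigma> permutes {..<N}}. perm_op N \<sigma> ys xs)"
  proof (rule sum.cong[OF refl])
    fix \<sigma> assume "\<sigma> \<in> {\<sigma>. \<sigma> permutes {..<N}}"
    then have \<sigma>: "\<sigma> permutes {..<N}" by simp
    have "xs = permute_list (inv_into UNIV \<sigma>) ys \<longleftrightarrow> ys = permute_list \<sigma> xs"
      using permute_list_inv[of \<sigma> xs] permute_list_inv[of \<sigma> ys] \<sigma> assms by metis
    then show "perm_op N (inv_into UNIV \<sigma>) xs ys = perm_op N \<sigma> ys xs"
      using perm_op_permute_list[OF permutes_inv[OF \<sigma>] assms] perm_op_permute_list[OF \<sigma> assms(2,1)] by simp
  qed
  finally show ?thesis by (simp add: sym_proj_def)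
qed

lemma sym_proj_nonzero:
  assumes "sym_proj N xs ys \<noteq> 0" "length xs = N" "length ys = N"
  shows "mset xs = mset ys"
proof -
  obtain \<sigma> where "\<sigma> permutes {..<N}" "perm_op N \<sigma> xs ys \<noteq> 0"
    using assms(1) unfolding sym_proj_def
    by (metis (no_types, lifting) div_0 mem_Collect_eq sum.neutral)
  then show ?thesis using assms(2,3) by (auto simp: perm_op_permute_list split: if_splits)
qed

text \<open>Each row of a permutation matrix has a single entry 1, in the column given by the
  inverse rearrangement.\<close>

lemma sum_sym_proj:
  assumes "finite D" "xs \<in> words D N"
  shows "(\<Sum>ys\<in>words D N. sym_proj N xs ys) = 1"
proof -
  have "(\<Sum>ys\<in>words D N. perm_op N \<sigma> xs ys) = 1" if \<sigma>: "\<sigma> permutes {..<N}" for \<sigma>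
  proof -
    have l: "length xs = N" using assms(2) by (simp add: words_def)
    have *: "permute_list (inv_into UNIV \<sigma>) xs \<in> words D N"
      using words_mset[OF assms(2)] permutes_inv[OF \<sigma>] l by simp
    have "(\<Sum>ys\<in>words D N. perm_op N \<sigma> xs ys) = (\<Sum>ys\<in>words D N. if ys = permute_list (inv_into UNIV \<sigma>) xs then 1 else 0)"
    proof (rule sum.cong[OF refl])
      fix ys assume "ys \<in> words D N"
      then have "length ys = N" by (simp add: words_def)
      moreover from this have "xs = permute_list \<sigma> ys \<longleftrightarrow> ys = permute_list (inv_into UNIV \<sigma>) xs"
        using permute_list_inv[of \<sigma> xs] permute_list_inv[of \<sigma> ys] \<sigma> l by metis
      ultimately show "perm_op N \<sigma> xs ys = (if ys = permute_list (inv_into UNIV \<sigma>) xs then 1 else 0)"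
        using perm_op_permute_list[OF \<sigma> l] by simp
    qed
    then show ?thesis using * assms(1) by simp
  qed
  then have "(\<Sum>ys\<in>words D N. \<Sum>\<sigma>\<in>{\<sigma>. \<sigma> permutes {..<N}}. perm_op N \<sigma> xs ys) = of_nat (fact N)"
    by (subst sum.swap) (simp add: card_permutations[OF refl])
  then show ?thesis by (simp add: sym_proj_def sum_divide_distrib[symmetric])
qed

text \<open>Row \<open>xs\<close> of the projector is supported on the rearrangements of
  \<open>xs\<close> and has total weight 1.\<close>

lemma sum_sym_proj_mult:
  assumes "finite D" "xs \<in> words D N" "\<And>ys. mset ys = mset xs \<Longrightarrow> g ys = g xs"
  shows "(\<Sum>ys\<in>words D N. sym_proj N xs ys * g ys) = g xs"
proof -
  have "(\<Sum>ys\<in>words D N. sym_proj N xs ys * g ys) = (\<Sum>ys\<in>words D N. sym_proj N xs ys * g xs)"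
  proof (rule sum.cong[OF refl])
    fix ys assume "ys \<in> words D N"
    then have "length xs = N" "length ys = N" using assms(2) by (auto simp: words_def)
    then have "sym_proj N xs ys = 0 \<or> mset ys = mset xs"
      using sym_proj_nonzero[of N xs ys] by metis
    then show "sym_proj N xs ys * g ys = sym_proj N xs ys * g xs"
      using assms(3)[of ys] by fastforce
  qed
  then show ?thesis using sum_sym_proj[OF assms(1,2)] by (simp add: sum_distrib_right[symmetric])
qed

lemma party_idx_eq: "party_idx n k = {..<n} \<times> {..<k}"
  by (auto simp: party_idx_def)

lemma finite_party_idx [simp]: "finite (party_idx n k)"
  by (simp add: party_idx_eq)

text \<open>The entries of the projector depend only on the multisets of letters and pass this on to
  the product; conversely, averaging fixes a symmetric kernel. From here on no sum over permutations
  occurs.\<close>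

lemma sym_proj_invariant_iff_word_sym:
  "(\<forall>xs\<in>multi_idx n k N. \<forall>ys\<in>multi_idx n k N.
      op_mult n k N (op_mult n k N (sym_proj N) \<Phi>) (sym_proj N) xs ys = \<Phi> xs ys)
   \<longleftrightarrow> word_sym (party_idx n k) N \<Phi>" (is "?L \<longleftrightarrow> ?R")
proof
  let ?W = "words (party_idx n k) N"
  assume inv: ?L
  show ?R unfolding word_sym_def
  proof (intro ballI allI impI)
    fix xs ys xs' ys'
    assume *: "xs \<in> ?W" "ys \<in> ?W" "mset xs' = mset xs" "mset ys' = mset ys"
    have **: "xs' \<in> ?W" "ys' \<in> ?W" using * words_mset by blast+
    have lw: "length zs = N" if "zs \<in> ?W" for zs using that by (simp add: words_def)
    have left: "sym_proj N xs' zs = sym_proj N xs zs" if "zs \<in> ?W" for zs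
      using sym_proj_permute_left[OF *(3)] lw * that by blast
    have right: "sym_proj N zs ys' = sym_proj N zs ys" if "zs \<in> ?W" for zs
      using sym_proj_permute_left[OF *(4), of N zs] sym_proj_commute[of zs N ys] sym_proj_commute[of zs N ys'] lw * ** that by metis
    have "\<Phi> xs' ys' = op_mult n k N (op_mult n k N (sym_proj N) \<Phi>) (sym_proj N) xs' ys'"
      using inv ** by (simp add: multi_idx_eq_words)
    also have "\<dots> = op_mult n k N (op_mult n k N (sym_proj N) \<Phi>) (sym_proj N) xs ys"
      by (simp add: op_mult_def multi_idx_eq_words left right cong: sum.cong)
    also have "\<dots> = \<Phi> xs ys" using inv * by (simp add: multi_idx_eq_words)
    finally show "\<Phi> xs' ys' = \<Phi> xs ys" .
  qed
next
  let ?W = "words (party_idx n k) N"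
  assume sym: ?R
  show ?L unfolding multi_idx_eq_words
  proof (intro ballI)
    fix xs ys assume *: "xs \<in> ?W" "ys \<in> ?W"
    have "op_mult n k N (sym_proj N) \<Phi> xs zs = \<Phi> xs zs" if "zs \<in> ?W" for zs
      unfolding op_mult_def multi_idx_eq_words
      by (rule sum_sym_proj_mult[OF finite_party_idx *(1)], rule word_symD[OF sym *(1) that _ refl])
    then have "op_mult n k N (op_mult n k N (sym_proj N) \<Phi>) (sym_proj N) xs ys
      = (\<Sum>zs\<in>?W. \<Phi> xs zs * sym_proj N zs ys)"
      by (simp add: op_mult_def[of n k N "op_mult n k N (sym_proj N) \<Phi>"] multi_idx_eq_words cong: sum.cong)
    also have "\<dots> = (\<Sum>zs\<in>?W. sym_proj N ys zs * \<Phi> xs zs)"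
    proof (rule sum.cong[OF refl])
      fix zs assume "zs \<in> ?W"
      then show "\<Phi> xs zs * sym_proj N zs ys = sym_proj N ys zs * \<Phi> xs zs"
        using * sym_proj_commute[of zs N ys] by (simp add: words_def)
    qed
    also have "\<dots> = \<Phi> xs ys"
      by (rule sum_sym_proj_mult[OF finite_party_idx *(2)], rule word_symD[OF sym * refl])
    finally show "op_mult n k N (op_mult n k N (sym_proj N) \<Phi>) (sym_proj N) xs ys = \<Phi> xs ys" .
  qed
qed

section \<open>Extendible states and conditioning\<close>

text \<open>Here and below, N counts the parties besides the first one. Every linear constraint on the first
  party is encoded by a coefficient matrix K to which the operator is orthogonal.\<close>

definition ext_cone :: "'a set \<Rightarrow> ('a \<Rightarrow> 'a \<Rightarrow> complex) set \<Rightarrow> nat \<Rightarrow> ('a list \<Rightarrow> 'a list \<Rightarrow> complex) \<Rightarrow> bool" where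
  "ext_cone D \<K> N \<Phi> \<longleftrightarrow> psd_on (words D (Suc N)) \<Phi> \<and> word_sym D (Suc N) \<Phi> \<and>
     (\<forall>K\<in>\<K>. \<forall>xs\<in>words D N. \<forall>ys\<in>words D N. (\<Sum>x\<in>D. \<Sum>y\<in>D. K x y * \<Phi> (x # xs) (y # ys)) = 0)"

definition marginal :: "'a set \<Rightarrow> nat \<Rightarrow> ('a list \<Rightarrow> 'a list \<Rightarrow> complex) \<Rightarrow> 'a \<Rightarrow> 'a \<Rightarrow> complex" where
  "marginal D N \<Phi> x y = (\<Sum>xs\<in>words D N. \<Phi> (x # xs) (y # xs))"

text \<open>The pair \<open>a x\<close> indexes the row and \<open>b y\<close> the column.
  \<open>N\<close> counts the traced parties, so the operator has N + 2.\<close>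

definition marginal2 :: "'a set \<Rightarrow> nat \<Rightarrow> ('a list \<Rightarrow> 'a list \<Rightarrow> complex) \<Rightarrow> 'a \<Rightarrow> 'a \<Rightarrow> 'a \<Rightarrow> 'a \<Rightarrow> complex" where
  "marginal2 D N \<Phi> a x b y = (\<Sum>xs\<in>words D N. \<Phi> (a # x # xs) (b # y # xs))"

definition ext_feasible :: "'a set \<Rightarrow> ('a \<Rightarrow> 'a \<Rightarrow> complex) set \<Rightarrow> nat \<Rightarrow> ('a list \<Rightarrow> 'a list \<Rightarrow> complex) \<Rightarrow> bool" where
  "ext_feasible D \<K> N \<Phi> \<longleftrightarrow> ext_cone D \<K> N \<Phi> \<and> (\<Sum>x\<in>D. marginal D N \<Phi> x x) = 1"

text \<open>Unnormalised state of the other parties after outcome \<open>v\<close> at the first one;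
  its trace is the probability of the outcome. Without a division, it passes to limits.\<close>

definition condition_on :: "'a set \<Rightarrow> ('a \<Rightarrow> complex) \<Rightarrow> ('a list \<Rightarrow> 'a list \<Rightarrow> complex) \<Rightarrow> 'a list \<Rightarrow> 'a list \<Rightarrow> complex" where
  "condition_on D v \<Phi> xs ys = (\<Sum>a\<in>D. \<Sum>b\<in>D. cnj (v a) * \<Phi> (a # xs) (b # ys) * v b)"

lemma psd_on_condition:
  assumes "psd_on (words D (Suc N)) \<Phi>"
  shows "psd_on (words D N) (condition_on D v \<Phi>)"
proof -
  \<comment> \<open>The form at \<open>u\<close> is the form of \<open>\<Phi>\<close> at the product
    vector of \<open>v\<close> and \<open>u\<close>.\<close>
  have *: "(\<Sum>xs\<in>words D N. \<Sum>ys\<in>words D N. cnj (u xs) * condition_on D v \<Phi> xs ys * u ys)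
      = (\<Sum>xs\<in>words D (Suc N). \<Sum>ys\<in>words D (Suc N).
          cnj (v (hd xs) * u (tl xs)) * \<Phi> xs ys * (v (hd ys) * u (tl ys)))" for u :: "'a list \<Rightarrow> complex"
  proof -
    have "(\<Sum>xs\<in>words D N. \<Sum>ys\<in>words D N. cnj (u xs) * condition_on D v \<Phi> xs ys * u ys)
      = (\<Sum>xs\<in>words D N. \<Sum>ys\<in>words D N. \<Sum>a\<in>D. \<Sum>b\<in>D. cnj (v a * u xs) * \<Phi> (a # xs) (b # ys) * (v b * u ys))"
      by (simp add: condition_on_def sum_distrib_left sum_distrib_right mult_ac)
    also have "\<dots> = (\<Sum>xs\<in>words D N. \<Sum>a\<in>D. \<Sum>ys\<in>words D N. \<Sum>b\<in>D. cnj (v a * u xs) * \<Phi> (a # xs) (b # ys) * (v b * u ys))"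
      by (rule sum.cong[OF refl], rule sum.swap)
    also have "\<dots> = (\<Sum>a\<in>D. \<Sum>xs\<in>words D N. \<Sum>ys\<in>words D N. \<Sum>b\<in>D. cnj (v a * u xs) * \<Phi> (a # xs) (b # ys) * (v b * u ys))"
      by (rule sum.swap)
    also have "\<dots> = (\<Sum>a\<in>D. \<Sum>xs\<in>words D N. \<Sum>b\<in>D. \<Sum>ys\<in>words D N. cnj (v a * u xs) * \<Phi> (a # xs) (b # ys) * (v b * u ys))"
      by (rule sum.cong[OF refl], rule sum.cong[OF refl], rule sum.swap)
    finally show ?thesis by (simp add: sum_words_Suc)
  qed
  show ?thesis
    by (rule psd_on_transfer[OF assms], rule exI, rule *)
qed

text \<open>The constraint on one party holds for all row and column words of the others, in
  particular for those starting with the measured letters.\<close>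

lemma ext_cone_condition:
  assumes "ext_cone D \<K> (Suc N) \<Phi>"
  shows "ext_cone D \<K> N (condition_on D v \<Phi>)"
proof -
  have sym: "word_sym D (Suc (Suc N)) \<Phi>" using assms by (simp add: ext_cone_def)
  have "word_sym D (Suc N) (condition_on D v \<Phi>)"
    unfolding word_sym_def condition_on_def
  proof (intro ballI allI impI sum.cong refl)
    fix xs ys xs' ys' a b
    assume *: "xs \<in> words D (Suc N)" "ys \<in> words D (Suc N)" "mset xs' = mset xs" "mset ys' = mset ys" "a \<in> D" "b \<in> D"
    have "\<Phi> (a # xs') (b # ys') = \<Phi> (a # xs) (b # ys)"
      by (rule word_symD[OF sym]) (use * in auto)
    then show "cnj (v a) * \<Phi> (a # xs') (b # ys') * v b = cnj (v a) * \<Phi> (a # xs) (b # ys) * v b" by simp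
  qed
  moreover have "(\<Sum>x\<in>D. \<Sum>y\<in>D. K x y * condition_on D v \<Phi> (x # xs) (y # ys)) = 0"
    if K: "K \<in> \<K>" "xs \<in> words D N" "ys \<in> words D N" for K xs ys
  proof -
    have "(\<Sum>x\<in>D. \<Sum>y\<in>D. K x y * condition_on D v \<Phi> (x # xs) (y # ys))
        = (\<Sum>x\<in>D. \<Sum>y\<in>D. \<Sum>a\<in>D. \<Sum>b\<in>D. cnj (v a) * v b * (K x y * \<Phi> (a # x # xs) (b # y # ys)))"
      by (simp add: condition_on_def sum_distrib_left mult_ac)
    also have "\<dots> = (\<Sum>x\<in>D. \<Sum>a\<in>D. \<Sum>y\<in>D. \<Sum>b\<in>D. cnj (v a) * v b * (K x y * \<Phi> (a # x # xs) (b # y # ys)))"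
      by (rule sum.cong[OF refl], rule sum.swap)
    also have "\<dots> = (\<Sum>a\<in>D. \<Sum>x\<in>D. \<Sum>y\<in>D. \<Sum>b\<in>D. cnj (v a) * v b * (K x y * \<Phi> (a # x # xs) (b # y # ys)))"
      by (rule sum.swap)
    also have "\<dots> = (\<Sum>a\<in>D. \<Sum>x\<in>D. \<Sum>b\<in>D. \<Sum>y\<in>D. cnj (v a) * v b * (K x y * \<Phi> (a # x # xs) (b # y # ys)))"
      by (rule sum.cong[OF refl], rule sum.cong[OF refl], rule sum.swap)
    also have "\<dots> = (\<Sum>a\<in>D. \<Sum>b\<in>D. \<Sum>x\<in>D. \<Sum>y\<in>D. cnj (v a) * v b * (K x y * \<Phi> (a # x # xs) (b # y # ys)))"
      by (rule sum.cong[OF refl], rule sum.swap)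
    \<comment> \<open>Conditioning measures the first party, and the constraint also refers to the
      first party; symmetry exchanges the two.\<close>
    also have "\<dots> = (\<Sum>a\<in>D. \<Sum>b\<in>D. cnj (v a) * v b * (\<Sum>x\<in>D. \<Sum>y\<in>D. K x y * \<Phi> (x # a # xs) (y # b # ys)))"
      unfolding sum_distrib_left
    proof (intro sum.cong refl)
      fix a b x y assume *: "a \<in> D" "b \<in> D" "x \<in> D" "y \<in> D"
      have "\<Phi> (a # x # xs) (b # y # ys) = \<Phi> (x # a # xs) (y # b # ys)"
        by (rule word_symD[OF sym]) (use * K in auto)
      then show "cnj (v a) * v b * (K x y * \<Phi> (a # x # xs) (b # y # ys)) = cnj (v a) * v b * (K x y * \<Phi> (x # a # xs) (y # b # ys))" by simp
    qed
    also have "\<dots> = 0"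
    proof (intro sum.neutral ballI)
      fix a b assume "a \<in> D" "b \<in> D"
      then have "(\<Sum>x\<in>D. \<Sum>y\<in>D. K x y * \<Phi> (x # a # xs) (y # b # ys)) = 0"
        using assms K unfolding ext_cone_def by (auto simp del: sum_eq_0_iff)
      then show "cnj (v a) * v b * (\<Sum>x\<in>D. \<Sum>y\<in>D. K x y * \<Phi> (x # a # xs) (y # b # ys)) = 0" by simp
    qed
    finally show ?thesis .
  qed
  ultimately show ?thesis
    using assms psd_on_condition[of D "Suc N" \<Phi> v] unfolding ext_cone_def by blast
qed

lemma ext_cone_scale:
  assumes "ext_cone D \<K> N \<Phi>" "0 \<le> c"
  shows "ext_cone D \<K> N (\<lambda>xs ys. complex_of_real c * \<Phi> xs ys)"
proof -
  have "(\<Sum>x\<in>D. \<Sum>y\<in>D. K x y * (complex_of_real c * \<Phi> (x # xs) (y # ys)))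
     = complex_of_real c * (\<Sum>x\<in>D. \<Sum>y\<in>D. K x y * \<Phi> (x # xs) (y # ys))" for K xs ys
    by (simp add: sum_distrib_left mult_ac)
  moreover have "word_sym D (Suc N) (\<lambda>xs ys. complex_of_real c * \<Phi> xs ys)"
    using assms(1) unfolding ext_cone_def word_sym_def by metis
  ultimately show ?thesis
    using assms psd_on_scale unfolding ext_cone_def by auto
qed

lemma psd_on_marginal:
  assumes "finite D" "ext_cone D \<K> N \<Phi>"
  shows "psd_on D (marginal D N \<Phi>)"
proof -
  have "psd_on D (\<lambda>x y. \<Phi> (x # xs) (y # xs))" if "xs \<in> words D N" for xs
    by (rule psd_on_reindex[of "words D (Suc N)" \<Phi> "\<lambda>x. x # xs"])
       (use assms that in \<open>auto simp: ext_cone_def inj_on_def\<close>)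
  then show ?thesis unfolding marginal_def by (rule psd_on_sum)
qed

lemma marginal_constraint:
  assumes "ext_cone D \<K> N \<Phi>" "K \<in> \<K>"
  shows "(\<Sum>x\<in>D. \<Sum>y\<in>D. K x y * marginal D N \<Phi> x y) = 0"
proof -
  have "(\<Sum>x\<in>D. \<Sum>y\<in>D. K x y * marginal D N \<Phi> x y)
      = (\<Sum>x\<in>D. \<Sum>xs\<in>words D N. \<Sum>y\<in>D. K x y * \<Phi> (x # xs) (y # xs))"
    unfolding marginal_def sum_distrib_left by (rule sum.cong[OF refl], rule sum.swap)
  also have "\<dots> = (\<Sum>xs\<in>words D N. \<Sum>x\<in>D. \<Sum>y\<in>D. K x y * \<Phi> (x # xs) (y # xs))"
    by (rule sum.swap)
  also have "\<dots> = 0"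
    by (rule sum.neutral) (use assms in \<open>unfold ext_cone_def, blast\<close>)
  finally show ?thesis .
qed

lemma marginal_condition:
  "marginal D N (condition_on D v \<Phi>) x y = (\<Sum>a\<in>D. \<Sum>b\<in>D. cnj (v a) * marginal2 D N \<Phi> a x b y * v b)"
proof -
  have "marginal D N (condition_on D v \<Phi>) x y
     = (\<Sum>a\<in>D. \<Sum>xs\<in>words D N. \<Sum>b\<in>D. cnj (v a) * \<Phi> (a # x # xs) (b # y # xs) * v b)"
    unfolding marginal_def condition_on_def by (rule sum.swap)
  also have "\<dots> = (\<Sum>a\<in>D. \<Sum>b\<in>D. \<Sum>xs\<in>words D N. cnj (v a) * \<Phi> (a # x # xs) (b # y # xs) * v b)"
    by (rule sum.cong[OF refl], rule sum.swap)
  finally show ?thesis by (simp add: marginal2_def sum_distrib_left sum_distrib_right)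
qed

text \<open>The first identity exchanges letters in the row only; it will force purity. The second
  exchanges the two parties and equates their marginals.\<close>

lemma marginal2_swap:
  assumes "ext_cone D \<K> (Suc N) \<Phi>" "a \<in> D" "x \<in> D" "b \<in> D" "y \<in> D"
  shows "marginal2 D N \<Phi> a x b y = marginal2 D N \<Phi> x a b y"
    and "marginal2 D N \<Phi> a x b y = marginal2 D N \<Phi> x a y b"
proof -
  have sym: "word_sym D (Suc (Suc N)) \<Phi>" using assms(1) by (simp add: ext_cone_def)
  show "marginal2 D N \<Phi> a x b y = marginal2 D N \<Phi> x a b y"
    unfolding marginal2_def
    by (rule sum.cong[OF refl], rule word_symD[OF sym]) (use assms in auto)
  show "marginal2 D N \<Phi> a x b y = marginal2 D N \<Phi> x a y b"
    unfolding marginal2_def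
    by (rule sum.cong[OF refl], rule word_symD[OF sym]) (use assms in auto)
qed

lemma marginal_Suc:
  assumes "ext_cone D \<K> (Suc N) \<Phi>" "a \<in> D" "b \<in> D"
  shows "marginal D (Suc N) \<Phi> a b = (\<Sum>x\<in>D. marginal2 D N \<Phi> a x b x)"
    and "marginal D (Suc N) \<Phi> a b = (\<Sum>x\<in>D. marginal2 D N \<Phi> x a x b)"
proof -
  show *: "marginal D (Suc N) \<Phi> a b = (\<Sum>x\<in>D. marginal2 D N \<Phi> a x b x)"
    by (simp add: marginal_def marginal2_def sum_words_Suc)
  show "marginal D (Suc N) \<Phi> a b = (\<Sum>x\<in>D. marginal2 D N \<Phi> x a x b)"
    unfolding * by (rule sum.cong[OF refl], rule marginal2_swap(2)[OF assms(1)]) (use assms in auto)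
qed

section \<open>The regularised objective and its convexity gap\<close>

definition mat_val :: "'a set \<Rightarrow> ('a \<Rightarrow> 'a \<Rightarrow> complex) \<Rightarrow> ('a \<Rightarrow> 'a \<Rightarrow> complex) \<Rightarrow> real" where
  "mat_val D W \<rho> = Re (\<Sum>x\<in>D. \<Sum>y\<in>D. W x y * \<rho> x y)"

definition sq_norm_on :: "'a set \<Rightarrow> ('a \<Rightarrow> 'a \<Rightarrow> complex) \<Rightarrow> real" where
  "sq_norm_on D \<rho> = (\<Sum>x\<in>D. \<Sum>y\<in>D. (cmod (\<rho> x y))\<^sup>2)"

lemma sq_norm_on_nonneg: "0 \<le> sq_norm_on D \<rho>"
  by (simp add: sq_norm_on_def sum_nonneg)

lemma sq_norm_on_eq_0D:
  assumes "finite D" "sq_norm_on D \<rho> = 0" "x \<in> D" "y \<in> D"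
  shows "\<rho> x y = 0"
proof -
  have "(\<Sum>y\<in>D. (cmod (\<rho> x y))\<^sup>2) = 0"
    using assms sum_nonneg_eq_0_iff[of D "\<lambda>x. \<Sum>y\<in>D. (cmod (\<rho> x y))\<^sup>2"]
    by (simp add: sq_norm_on_def sum_nonneg)
  then show ?thesis
    using assms sum_nonneg_eq_0_iff[of D "\<lambda>y. (cmod (\<rho> x y))\<^sup>2"] by simp
qed

lemma mat_val_convex_comb:
  assumes "\<And>x y. x \<in> D \<Longrightarrow> y \<in> D \<Longrightarrow> \<rho> x y = (\<Sum>s\<in>S. complex_of_real (p s) * r s x y)"
  shows "mat_val D W \<rho> = (\<Sum>s\<in>S. p s * mat_val D W (r s))"
proof -
  have "(\<Sum>x\<in>D. \<Sum>y\<in>D. W x y * \<rho> x y) = (\<Sum>x\<in>D. \<Sum>y\<in>D. \<Sum>s\<in>S. complex_of_real (p s) * (W x y * r s x y))"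
    by (intro sum.cong refl) (simp add: assms sum_distrib_left mult_ac)
  also have "\<dots> = (\<Sum>x\<in>D. \<Sum>s\<in>S. \<Sum>y\<in>D. complex_of_real (p s) * (W x y * r s x y))"
    by (rule sum.cong[OF refl], rule sum.swap)
  also have "\<dots> = (\<Sum>s\<in>S. \<Sum>x\<in>D. \<Sum>y\<in>D. complex_of_real (p s) * (W x y * r s x y))"
    by (rule sum.swap)
  also have "\<dots> = (\<Sum>s\<in>S. complex_of_real (p s) * (\<Sum>x\<in>D. \<Sum>y\<in>D. W x y * r s x y))"
    by (simp add: sum_distrib_left)
  finally show ?thesis unfolding mat_val_def by (simp del: Re_sum Im_sum add: Re_sum[of _ S])
qed

text \<open>Strict convexity of the squared modulus as an identity: second moment equals squared
  mean plus variance.\<close>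

lemma variance_decomposition:
  fixes z :: "'s \<Rightarrow> complex" and p :: "'s \<Rightarrow> real"
  assumes "(\<Sum>s\<in>S. p s) = 1" "(\<Sum>s\<in>S. complex_of_real (p s) * z s) = m"
  shows "(\<Sum>s\<in>S. p s * (cmod (z s))\<^sup>2) = (cmod m)\<^sup>2 + (\<Sum>s\<in>S. p s * (cmod (z s - m))\<^sup>2)"
proof -
  have *: "p s * (cmod (z s - m))\<^sup>2 = p s * (cmod (z s))\<^sup>2 - 2 * (Re m * (p s * Re (z s)) + Im m * (p s * Im (z s)))
     + (cmod m)\<^sup>2 * p s" for s
    unfolding cmod_power2 by (simp add: power2_eq_square algebra_simps)
  have "Re m = (\<Sum>s\<in>S. p s * Re (z s))" "Im m = (\<Sum>s\<in>S. p s * Im (z s))"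
    by (simp_all add: assms(2)[symmetric])
  then have "(\<Sum>s\<in>S. p s * (cmod (z s - m))\<^sup>2) = (\<Sum>s\<in>S. p s * (cmod (z s))\<^sup>2) - 2 * (Re m * Re m + Im m * Im m) + (cmod m)\<^sup>2"
    unfolding * by (simp add: sum.distrib sum_subtractf sum_distrib_left[symmetric] assms(1))
  moreover have "Re m * Re m + Im m * Im m = (cmod m)\<^sup>2"
    unfolding cmod_power2 by (simp add: power2_eq_square)
  ultimately show ?thesis by (simp only:)
qed

lemma sq_norm_on_convex_comb:
  assumes "(\<Sum>s\<in>S. p s) = 1"
    and "\<And>x y. x \<in> D \<Longrightarrow> y \<in> D \<Longrightarrow> \<rho> x y = (\<Sum>s\<in>S. complex_of_real (p s) * r s x y)"
  shows "(\<Sum>s\<in>S. p s * sq_norm_on D (r s))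
     = sq_norm_on D \<rho> + (\<Sum>s\<in>S. p s * sq_norm_on D (\<lambda>x y. r s x y - \<rho> x y))"
proof -
  have swap: "(\<Sum>s\<in>S. p s * sq_norm_on D (q s)) = (\<Sum>x\<in>D. \<Sum>y\<in>D. \<Sum>s\<in>S. p s * (cmod (q s x y))\<^sup>2)" for q
  proof -
    have "(\<Sum>s\<in>S. p s * sq_norm_on D (q s)) = (\<Sum>x\<in>D. \<Sum>s\<in>S. \<Sum>y\<in>D. p s * (cmod (q s x y))\<^sup>2)"
      unfolding sq_norm_on_def sum_distrib_left by (rule sum.swap)
    also have "\<dots> = (\<Sum>x\<in>D. \<Sum>y\<in>D. \<Sum>s\<in>S. p s * (cmod (q s x y))\<^sup>2)"
      by (rule sum.cong[OF refl], rule sum.swap)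
    finally show ?thesis .
  qed
  show ?thesis
    unfolding swap sq_norm_on_def[of D \<rho>] sum.distrib[symmetric]
    by (intro sum.cong refl variance_decomposition[OF assms(1)]) (simp add: assms(2))
qed

text \<open>Normalised conditional states are feasible one level down, so their regularised values
  are at most \<open>h\<close>. Their average reproduces the linear value and exceeds the quadratic
  one by the variance, so \<open>t\<close> times the variance is bounded by the gap to
  \<open>h\<close>. Only one outcome is kept and denominators are cleared, in view of limits;
  \<open>t = 0\<close> gives monotonicity.\<close>

lemma condition_average:
  assumes D: "finite D" and S: "finite S"
    and res: "\<And>a b. a \<in> D \<Longrightarrow> b \<in> D \<Longrightarrow> (\<Sum>s\<in>S. cnj (v s a) * v s b) = (if a = b then 1 else 0)"
    and feas: "ext_feasible D \<K> (Suc N) \<Phi>"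
    and h: "\<And>\<Psi>. ext_feasible D \<K> N \<Psi> \<Longrightarrow> mat_val D W (marginal D N \<Psi>) + t * sq_norm_on D (marginal D N \<Psi>) \<le> h"
    and t: "0 \<le> t" and s: "s0 \<in> S"
  shows "mat_val D W (marginal D (Suc N) \<Phi>) + t * sq_norm_on D (marginal D (Suc N) \<Phi>)
     + t * sq_norm_on D (\<lambda>x y. marginal D N (condition_on D (v s0) \<Phi>) x y
         - (\<Sum>z\<in>D. marginal D N (condition_on D (v s0) \<Phi>) z z) * marginal D (Suc N) \<Phi> x y) \<le> h"
proof -
  define \<rho> where "\<rho> = marginal D (Suc N) \<Phi>"
  define \<sigma> where "\<sigma> s = marginal D N (condition_on D (v s) \<Phi>)" for s
  define p where "p s = Re (\<Sum>z\<in>D. \<sigma> s z z)" for s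
  \<comment> \<open>The default is immaterial: it occurs only with weight
    \<open>p s = 0\<close>.\<close>
  define r where "r s x y = (if p s = 0 then \<rho> x y else \<sigma> s x y / complex_of_real (p s))" for s x y
  have cone: "ext_cone D \<K> (Suc N) \<Phi>" and tr: "(\<Sum>z\<in>D. \<rho> z z) = 1"
    using feas by (auto simp: ext_feasible_def \<rho>_def)
  have conec: "ext_cone D \<K> N (condition_on D (v s) \<Phi>)" for s
    by (rule ext_cone_condition[OF cone])
  have psd: "psd_on D (\<sigma> s)" for s
    unfolding \<sigma>_def by (rule psd_on_marginal[OF D conec])
  have p: "(\<Sum>z\<in>D. \<sigma> s z z) = complex_of_real (p s)" "0 \<le> p s" for s
    using psd_on_trace_nonneg[OF psd D, of s] unfolding p_def by auto
  \<comment> \<open>By \<open>res\<close>, summing over the outcomes traces out the measured party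
    and leaves the marginal of the second, which equals that of the first.\<close>
  have sum_\<sigma>: "(\<Sum>s\<in>S. \<sigma> s x y) = \<rho> x y" if "x \<in> D" "y \<in> D" for x y
  proof -
    have "(\<Sum>s\<in>S. \<sigma> s x y) = (\<Sum>a\<in>D. \<Sum>s\<in>S. \<Sum>b\<in>D. cnj (v s a) * marginal2 D N \<Phi> a x b y * v s b)"
      unfolding \<sigma>_def marginal_condition by (rule sum.swap)
    also have "\<dots> = (\<Sum>a\<in>D. \<Sum>b\<in>D. \<Sum>s\<in>S. cnj (v s a) * marginal2 D N \<Phi> a x b y * v s b)"
      by (rule sum.cong[OF refl], rule sum.swap)
    also have "\<dots> = (\<Sum>a\<in>D. \<Sum>b\<in>D. marginal2 D N \<Phi> a x b y * (\<Sum>s\<in>S. cnj (v s a) * v s b))"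
      by (simp add: sum_distrib_left mult_ac)
    also have "\<dots> = (\<Sum>a\<in>D. \<Sum>b\<in>D. if a = b then marginal2 D N \<Phi> a x b y else 0)"
      by (intro sum.cong refl) (simp add: res)
    also have "\<dots> = (\<Sum>a\<in>D. marginal2 D N \<Phi> a x a y)"
      using D by (intro sum.cong refl) simp
    finally show ?thesis using marginal_Suc(2)[OF cone that] by (simp add: \<rho>_def)
  qed
  have "complex_of_real (\<Sum>s\<in>S. p s) = (\<Sum>s\<in>S. \<Sum>z\<in>D. \<sigma> s z z)" by (simp add: p)
  also have "\<dots> = (\<Sum>z\<in>D. \<Sum>s\<in>S. \<sigma> s z z)" by (rule sum.swap)
  also have "\<dots> = 1" using sum_\<sigma> tr by simp
  finally have p1: "(\<Sum>s\<in>S. p s) = 1" using of_real_eq_1_iff by blast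
  \<comment> \<open>For \<open>p s = 0\<close> the left side vanishes too, being an entry of a
    positive kernel of trace zero.\<close>
  have \<sigma>r: "\<sigma> s x y = complex_of_real (p s) * r s x y" if "x \<in> D" "y \<in> D" for s x y
  proof (cases "p s = 0")
    case True
    then show ?thesis
      using psd_on_norm_le_trace[OF psd D that, of s] by (simp add: p_def)
  qed (simp add: r_def)
  have comb: "\<rho> x y = (\<Sum>s\<in>S. complex_of_real (p s) * r s x y)" if "x \<in> D" "y \<in> D" for x y
    using sum_\<sigma>[OF that] \<sigma>r[OF that] by simp
  have bound: "p s * (mat_val D W (r s) + t * sq_norm_on D (r s)) \<le> p s * h" for s
  proof (cases "p s = 0")
    case False
    let ?\<Psi> = "\<lambda>xs ys. complex_of_real (1 / p s) * condition_on D (v s) \<Phi> xs ys"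
    have m: "marginal D N ?\<Psi> = r s"
      using False by (intro ext) (simp add: r_def \<sigma>_def marginal_def sum_divide_distrib)
    have "(\<Sum>z\<in>D. r s z z) = 1"
      using p(1)[of s] False by (simp add: r_def sum_divide_distrib[symmetric])
    then have "ext_feasible D \<K> N ?\<Psi>"
      using ext_cone_scale[OF conec, of "1 / p s" s] p(2)[of s] by (simp add: ext_feasible_def m del: of_real_divide)
    from h[OF this, unfolded m] show ?thesis using p(2)[of s] by (intro mult_left_mono)
  qed simp
  have "(\<Sum>s\<in>S. p s * (mat_val D W (r s) + t * sq_norm_on D (r s))) \<le> (\<Sum>s\<in>S. p s * h)"
    by (intro sum_mono bound)
  also have "\<dots> = h" using p1 by (simp add: sum_distrib_right[symmetric])
  also have "(\<Sum>s\<in>S. p s * (mat_val D W (r s) + t * sq_norm_on D (r s)))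
     = (\<Sum>s\<in>S. p s * mat_val D W (r s)) + t * (\<Sum>s\<in>S. p s * sq_norm_on D (r s))"
    by (simp add: algebra_simps sum.distrib sum_distrib_left)
  also have "\<dots> = mat_val D W \<rho> + t * (sq_norm_on D \<rho> + (\<Sum>s\<in>S. p s * sq_norm_on D (\<lambda>x y. r s x y - \<rho> x y)))"
    using mat_val_convex_comb[where r = r and W = W, OF comb] sq_norm_on_convex_comb[where r = r, OF p1 comb] by simp
  finally have main: "mat_val D W \<rho> + t * (sq_norm_on D \<rho> + (\<Sum>s\<in>S. p s * sq_norm_on D (\<lambda>x y. r s x y - \<rho> x y))) \<le> h" .
  have ple: "p s0 \<le> 1"
    using member_le_sum[of s0 S p] s S p(2) p1 by simp
  \<comment> \<open>The unnormalised deviation carries the square of the probability, the variance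
    its first power; \<open>p s0 \<le> 1\<close> compares them.\<close>
  have "sq_norm_on D (\<lambda>x y. \<sigma> s0 x y - (\<Sum>z\<in>D. \<sigma> s0 z z) * \<rho> x y)
      = p s0 * (p s0 * sq_norm_on D (\<lambda>x y. r s0 x y - \<rho> x y))"
  proof -
    have "(cmod (\<sigma> s0 x y - complex_of_real (p s0) * \<rho> x y))\<^sup>2 = p s0 * (p s0 * (cmod (r s0 x y - \<rho> x y))\<^sup>2)"
      if "x \<in> D" "y \<in> D" for x y
    proof -
      have "\<sigma> s0 x y - complex_of_real (p s0) * \<rho> x y = complex_of_real (p s0) * (r s0 x y - \<rho> x y)"
        using \<sigma>r[OF that] by (simp add: algebra_simps)
      then show ?thesis by (simp add: norm_mult power_mult_distrib power2_eq_square)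
    qed
    then show ?thesis by (simp add: sq_norm_on_def p sum_distrib_left)
  qed
  also have "\<dots> \<le> 1 * (p s0 * sq_norm_on D (\<lambda>x y. r s0 x y - \<rho> x y))"
    using ple p(2)[of s0] by (intro mult_right_mono) (simp_all add: sq_norm_on_nonneg)
  also have "\<dots> \<le> (\<Sum>s\<in>S. p s * sq_norm_on D (\<lambda>x y. r s x y - \<rho> x y))"
    using member_le_sum[of s0 S "\<lambda>s. p s * sq_norm_on D (\<lambda>x y. r s x y - \<rho> x y)"] s S p(2)
    by (simp add: sq_norm_on_nonneg)
  finally have "t * sq_norm_on D (\<lambda>x y. \<sigma> s0 x y - (\<Sum>z\<in>D. \<sigma> s0 z z) * \<rho> x y)
      \<le> t * (\<Sum>s\<in>S. p s * sq_norm_on D (\<lambda>x y. r s x y - \<rho> x y))"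
    by (rule mult_left_mono[OF _ t])
  with main show ?thesis unfolding \<rho>_def \<sigma>_def by (simp add: algebra_simps)
qed

section \<open>Limits of extendible states\<close>

lemma finite_family_convergent_subseq:
  fixes f :: "nat \<Rightarrow> 'a \<Rightarrow> complex"
  assumes "finite A" "\<And>n x. x \<in> A \<Longrightarrow> cmod (f n x) \<le> B"
  shows "\<exists>r g. strict_mono r \<and> (\<forall>x\<in>A. (\<lambda>n. f (r n) x) \<longlonglongrightarrow> g x)"
  using assms
proof (induction A rule: finite_induct)
  case empty
  show ?case by (auto intro!: exI[of _ id] simp: strict_mono_def)
next
  case (insert a A)
  then obtain r g where r: "strict_mono r" "\<And>x. x \<in> A \<Longrightarrow> (\<lambda>n. f (r n) x) \<longlonglongrightarrow> g x"
    by (metis insertCI)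
  have "bounded (range (\<lambda>n. f (r n) a))"
    using insert.prems by (auto simp: bounded_iff)
  then obtain l q where q: "strict_mono q" "((\<lambda>n. f (r n) a) \<circ> q) \<longlonglongrightarrow> l"
    using bounded_imp_convergent_subsequence by blast
  have "(\<lambda>n. f ((r \<circ> q) n) x) \<longlonglongrightarrow> (g(a := l)) x" if "x \<in> insert a A" for x
  proof (cases "x = a")
    case True
    then show ?thesis using q(2) by (simp add: o_def)
  next
    case False
    then show ?thesis
      using LIMSEQ_subseq_LIMSEQ[OF r(2) q(1), of x] that by (simp add: o_def)
  qed
  then show ?case using strict_mono_o[OF r(1) q(1)] by blast
qed

lemma psd_on_lim:
  assumes "\<And>n. psd_on A (f n)" "\<And>x y. x \<in> A \<Longrightarrow> y \<in> A \<Longrightarrow> (\<lambda>n. f n x y) \<longlonglongrightarrow> g x y"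
  shows "psd_on A g"
  unfolding psd_on_def
proof (intro allI conjI)
  fix v :: "'a \<Rightarrow> complex"
  have lim: "(\<lambda>n. \<Sum>x\<in>A. \<Sum>y\<in>A. cnj (v x) * f n x y * v y) \<longlonglongrightarrow> (\<Sum>x\<in>A. \<Sum>y\<in>A. cnj (v x) * g x y * v y)"
    by (intro tendsto_intros assms(2))
  show "(\<Sum>x\<in>A. \<Sum>y\<in>A. cnj (v x) * g x y * v y) \<in> \<real>"
    by (rule closed_sequentially[OF closed_complex_Reals _ lim]) (rule psd_onD(1)[OF assms(1)])
  show "0 \<le> Re (\<Sum>x\<in>A. \<Sum>y\<in>A. cnj (v x) * g x y * v y)"
    by (rule LIMSEQ_le_const[OF tendsto_Re[OF lim]]) (use psd_onD(2)[OF assms(1)] in blast)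
qed

section \<open>Measurement in polarisation vectors\<close>

definition polar_phases :: "complex set" where
  "polar_phases = {1, -1, \<i>, -\<i>}"

text \<open>An informationally complete measurement: by polarisation, the quadratic form of a matrix at
  these vectors determines it. The scaling makes the projections sum to the identity.\<close>

definition polar_vec :: "'a set \<Rightarrow> 'a \<times> 'a \<times> complex \<Rightarrow> 'a \<Rightarrow> complex" where
  "polar_vec D = (\<lambda>(p, q, c) x. complex_of_real (1 / sqrt (8 * real (card D))) * (of_bool (x = p) + c * of_bool (x = q)))"

lemma finite_polar_phases [simp]: "finite polar_phases"
  by (simp add: polar_phases_def)

lemma sum_polar_phases: "(\<Sum>c\<in>polar_phases. f c) = f 1 + f (-1) + f \<i> + f (-\<i>)"
  by (simp add: polar_phases_def complex_eq_iff add.assoc)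

text \<open>Summing over the fourth roots of unity cancels the cross terms and leaves weight 4 at
  \<open>p\<close> and at \<open>q\<close>. Over all pairs this is 8 times \<open>card D\<close> on
  the diagonal, whence the constant in \<open>polar_vec\<close>. Pairs with \<open>p = q\<close> fit
  the same count.\<close>

lemma polar_vec_resolution:
  assumes D: "finite D" and ab: "a \<in> D" "b \<in> D"
  shows "(\<Sum>s\<in>D \<times> D \<times> polar_phases. cnj (polar_vec D s a) * polar_vec D s b) = (if a = b then 1 else 0)"
proof -
  define d where "d = card D"
  have d: "d > 0" using D ab by (auto simp: d_def card_gt_0_iff)
  have k: "complex_of_real (1 / sqrt (8 * real d)) * complex_of_real (1 / sqrt (8 * real d)) = 1 / (8 * of_nat d)"
    unfolding of_real_mult[symmetric] by (simp add: real_sqrt_mult[symmetric])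
  have phase: "(\<Sum>c\<in>polar_phases. cnj (polar_vec D (p, q, c) a) * polar_vec D (p, q, c) b)
     = 1 / (8 * of_nat d) * (4 * of_bool (a = p \<and> b = p) + 4 * of_bool (a = q \<and> b = q))" for p q
  proof -
    have "cnj (polar_vec D (p, q, c) a) * polar_vec D (p, q, c) b
       = 1 / (8 * of_nat d) * ((of_bool (a = p) + cnj c * of_bool (a = q)) * (of_bool (b = p) + c * of_bool (b = q)))" for c
      unfolding k[symmetric] by (simp add: polar_vec_def d_def)
    then show ?thesis
      by (simp only: sum_distrib_left[symmetric] sum_polar_phases) (simp add: algebra_simps of_bool_conj)
  qed
  have "(\<Sum>s\<in>D \<times> D \<times> polar_phases. cnj (polar_vec D s a) * polar_vec D s b)
      = (\<Sum>p\<in>D. \<Sum>q\<in>D. \<Sum>c\<in>polar_phases. cnj (polar_vec D (p, q, c) a) * polar_vec D (p, q, c) b)"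
    by (simp add: sum.cartesian_product case_prod_unfold)
  also have "\<dots> = 1 / (8 * of_nat d) * (\<Sum>p\<in>D. \<Sum>q\<in>D. 4 * of_bool (a = p \<and> b = p) + 4 * of_bool (a = q \<and> b = q))"
    unfolding phase sum_distrib_left ..
  also have "(\<Sum>p\<in>D. \<Sum>q\<in>D. 4 * of_bool (a = p \<and> b = p) + 4 * of_bool (a = q \<and> b = q) :: complex)
     = 8 * of_nat d * of_bool (a = b)"
  proof -
    have "(\<Sum>p\<in>D. of_bool (a = p \<and> b = p) :: complex) = (\<Sum>p\<in>D. if a = p then of_bool (a = b) else 0)"
      by (rule sum.cong) auto
    then have "(\<Sum>p\<in>D. of_bool (a = p \<and> b = p) :: complex) = of_bool (a = b)"
      using D ab by simp
    then show ?thesis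
      by (simp add: sum.distrib sum_distrib_left[symmetric] d_def del: sum_of_bool_eq)
  qed
  finally show ?thesis using d by simp
qed

lemma polar_vec_form:
  assumes D: "finite D" and "p \<in> D" "q \<in> D"
  shows "(\<Sum>a\<in>D. \<Sum>b\<in>D. cnj (polar_vec D (p, q, c) a) * f a b * polar_vec D (p, q, c) b)
     = 1 / (8 * of_nat (card D)) * (f p p + c * f p q + cnj c * f q p + cnj c * c * f q q)"
proof -
  define \<kappa> where "\<kappa> = complex_of_real (1 / sqrt (8 * real (card D)))"
  have k: "\<kappa> * \<kappa> = 1 / (8 * of_nat (card D))"
    unfolding \<kappa>_def of_real_mult[symmetric] by (simp add: real_sqrt_mult[symmetric])
  have v: "polar_vec D (p, q, c) a = \<kappa> * (of_bool (a = p) + c * of_bool (a = q))" for a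
    by (simp add: polar_vec_def \<kappa>_def)
  have cv: "cnj (polar_vec D (p, q, c) a) = \<kappa> * (of_bool (a = p) + cnj c * of_bool (a = q))" for a
    by (simp add: polar_vec_def \<kappa>_def)
  have sel: "(\<Sum>a\<in>D. g a * of_bool (a = z)) = g z" if "z \<in> D" for g :: "'a \<Rightarrow> complex" and z
  proof -
    have "(\<Sum>a\<in>D. g a * of_bool (a = z)) = (\<Sum>a\<in>D. if a = z then g a else 0)"
      by (rule sum.cong) auto
    then show ?thesis using D that by simp
  qed
  have inner: "(\<Sum>b\<in>D. g b * polar_vec D (p, q, c) b) = \<kappa> * (g p + c * g q)" for g
  proof -
    have "(\<Sum>b\<in>D. g b * polar_vec D (p, q, c) b) = (\<Sum>b\<in>D. \<kappa> * g b * of_bool (b = p)) + (\<Sum>b\<in>D. \<kappa> * c * g b * of_bool (b = q))"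
      unfolding v by (simp only: sum.distrib[symmetric]) (simp add: algebra_simps)
    then show ?thesis unfolding sel[OF assms(2)] sel[OF assms(3)] by (simp add: algebra_simps)
  qed
  have outer: "(\<Sum>a\<in>D. cnj (polar_vec D (p, q, c) a) * g a) = \<kappa> * (g p + cnj c * g q)" for g
  proof -
    have "(\<Sum>a\<in>D. cnj (polar_vec D (p, q, c) a) * g a) = (\<Sum>b\<in>D. \<kappa> * g b * of_bool (b = p)) + (\<Sum>b\<in>D. \<kappa> * cnj c * g b * of_bool (b = q))"
      unfolding cv by (simp only: sum.distrib[symmetric]) (simp add: algebra_simps)
    then show ?thesis unfolding sel[OF assms(2)] sel[OF assms(3)] by (simp add: algebra_simps)
  qed
  have "(\<Sum>a\<in>D. \<Sum>b\<in>D. cnj (polar_vec D (p, q, c) a) * f a b * polar_vec D (p, q, c) b)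
     = (\<Sum>a\<in>D. cnj (polar_vec D (p, q, c) a) * (\<Sum>b\<in>D. f a b * polar_vec D (p, q, c) b))"
    by (simp add: sum_distrib_left mult.assoc)
  also have "\<dots> = \<kappa> * \<kappa> * (f p p + c * f p q + cnj c * f q p + cnj c * c * f q q)"
    unfolding inner outer by (simp add: algebra_simps)
  finally show ?thesis unfolding k .
qed

text \<open>The real phases give \<open>f p q + f q p = 0\<close>, the imaginary ones
  \<open>f p q - f q p = 0\<close>. This covers non-Hermitian \<open>f\<close>, such as slices of a
  two-party operator with the other letters fixed.\<close>

lemma polar_vec_separates:
  assumes D: "finite D" and pq: "p \<in> D" "q \<in> D"
    and z: "\<And>s. s \<in> D \<times> D \<times> polar_phases \<Longrightarrow> (\<Sum>a\<in>D. \<Sum>b\<in>D. cnj (polar_vec D s a) * f a b * polar_vec D s b) = 0"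
  shows "f p q = 0"
proof -
  have d: "card D > 0" using D pq by (auto simp: card_gt_0_iff)
  have *: "f p p + c * f p q + cnj c * f q p + cnj c * c * f q q = 0" if "c \<in> polar_phases" for c
    using z[of "(p, q, c)"] that pq d unfolding polar_vec_form[OF D pq] by simp
  have **: "f p p + f p q + f q p + f q q = 0" "f p p - f p q - f q p + f q q = 0"
    "f p p + \<i> * f p q - \<i> * f q p + f q q = 0" "f p p - \<i> * f p q + \<i> * f q p + f q q = 0"
    using *[of 1] *[of "-1"] *[of \<i>] *[of "-\<i>"] by (simp_all add: polar_phases_def)
  then show ?thesis by (auto simp: complex_eq_iff)
qed

text \<open>The exchange identity says that all 2x2 minors vanish, so a column through a nonzero
  diagonal entry determines the kernel.\<close>

lemma psd_on_pure:
  assumes D: "finite D" and psd: "psd_on D \<rho>" and tr: "(\<Sum>x\<in>D. \<rho> x x) \<noteq> 0"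
    and swap: "\<And>a b x y. a \<in> D \<Longrightarrow> b \<in> D \<Longrightarrow> x \<in> D \<Longrightarrow> y \<in> D \<Longrightarrow> \<rho> a b * \<rho> x y = \<rho> x b * \<rho> a y"
  shows "\<exists>\<psi>. \<forall>x\<in>D. \<forall>y\<in>D. \<rho> x y = \<psi> x * cnj (\<psi> y)"
proof -
  obtain l where l: "l \<in> D" "\<rho> l l \<noteq> 0" using tr by (meson sum.neutral)
  have ll: "\<rho> l l = complex_of_real (Re (\<rho> l l))" "Re (\<rho> l l) > 0"
    using psd_on_diag[OF psd D l(1)] l(2) by (auto simp: complex_is_Real_iff complex_eq_iff less_le)
  define \<psi> where "\<psi> x = \<rho> x l / complex_of_real (sqrt (Re (\<rho> l l)))" for x
  have "\<rho> x y = \<psi> x * cnj (\<psi> y)" if "x \<in> D" "y \<in> D" for x y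
  proof -
    have "complex_of_real (sqrt (Re (\<rho> l l))) * complex_of_real (sqrt (Re (\<rho> l l))) = \<rho> l l"
      unfolding of_real_mult[symmetric] using ll by simp
    then have "\<psi> x * cnj (\<psi> y) = \<rho> x l * \<rho> l y / \<rho> l l"
      using psd_on_hermitian[OF psd D that(2) l(1)] by (simp add: \<psi>_def)
    also have "\<dots> = \<rho> x y" using swap[of x l l y] l that by simp
    finally show ?thesis by simp
  qed
  then show ?thesis by blast
qed

section \<open>Compactness and passage to the limit\<close>

lemma marginal_bound:
  assumes "finite D" "ext_feasible D \<K> N \<Phi>" "x \<in> D" "y \<in> D"
  shows "cmod (marginal D N \<Phi> x y) \<le> 1"
  using psd_on_norm_le_trace[OF psd_on_marginal[OF assms(1)] assms(1,3,4), of \<K> N \<Phi>] assms(2)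
  unfolding ext_feasible_def by simp

lemma marginal2_bound:
  assumes D: "finite D" and feas: "ext_feasible D \<K> (Suc N) \<Phi>" and mem: "a \<in> D" "x \<in> D" "b \<in> D" "y \<in> D"
  shows "cmod (marginal2 D N \<Phi> a x b y) \<le> 1"
proof -
  let ?f = "\<lambda>i j. marginal2 D N \<Phi> (fst i) (snd i) (fst j) (snd j)"
  have cone: "ext_cone D \<K> (Suc N) \<Phi>" using feas by (simp add: ext_feasible_def)
  have "psd_on (D \<times> D) (\<lambda>i j. \<Phi> (fst i # snd i # xs) (fst j # snd j # xs))" if "xs \<in> words D N" for xs
    by (rule psd_on_reindex[of "words D (Suc (Suc N))" \<Phi> "\<lambda>i. fst i # snd i # xs"])
       (use cone D that in \<open>auto simp: ext_cone_def inj_on_def\<close>)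
  then have "psd_on (D \<times> D) ?f" unfolding marginal2_def by (rule psd_on_sum)
  moreover have "(\<Sum>i\<in>D \<times> D. ?f i i) = 1"
  proof -
    have "(\<Sum>i\<in>D \<times> D. ?f i i) = (\<Sum>a\<in>D. \<Sum>x\<in>D. marginal2 D N \<Phi> a x a x)"
      by (simp add: sum.cartesian_product case_prod_unfold)
    also have "\<dots> = (\<Sum>a\<in>D. marginal D (Suc N) \<Phi> a a)"
      using marginal_Suc(1)[OF cone] by (intro sum.cong) auto
    finally show ?thesis using feas by (simp add: ext_feasible_def)
  qed
  ultimately show ?thesis
    using psd_on_norm_le_trace[of "D \<times> D" ?f "(a, x)" "(b, y)"] D mem by simp
qed

text \<open>The regularised optima \<open>h\<close> decrease and stay above \<open>c\<close>, hence
  converge; deviations of near-maximisers are at most their decrease plus the slack, divided by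
  \<open>t\<close>. The loss \<open>t\<close> in the conclusion is the quadratic term of the pure
  limit.\<close>

lemma extendible_limit_pure:
  fixes D :: "'a set"
  assumes D: "finite D" and t: "0 < t"
    and ex: "\<And>N. \<exists>\<Phi>. ext_feasible D \<K> N \<Phi> \<and> c \<le> mat_val D W (marginal D N \<Phi>)"
  shows "\<exists>\<psi>. (\<Sum>x\<in>D. \<psi> x * cnj (\<psi> x)) = 1 \<and>
    (\<forall>K\<in>\<K>. (\<Sum>x\<in>D. \<Sum>y\<in>D. K x y * (\<psi> x * cnj (\<psi> y))) = 0) \<and>
    c - t \<le> mat_val D W (\<lambda>x y. \<psi> x * cnj (\<psi> y))"
proof -
  define H where "H \<rho> = mat_val D W \<rho> + t * sq_norm_on D \<rho>" for \<rho> :: "'a \<Rightarrow> 'a \<Rightarrow> complex"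
  define V where "V N = {H (marginal D N \<Phi>) | \<Phi>. ext_feasible D \<K> N \<Phi>}" for N
  define h where "h N = Sup (V N)" for N
  have Hbound: "H (marginal D N \<Phi>) \<le> (\<Sum>x\<in>D. \<Sum>y\<in>D. cmod (W x y)) + t * (\<Sum>x\<in>D. \<Sum>y\<in>D. 1)"
    if "ext_feasible D \<K> N \<Phi>" for N \<Phi>
  proof -
    note b = marginal_bound[OF D that]
    have "Re (W x y * marginal D N \<Phi> x y) \<le> cmod (W x y)" if "x \<in> D" "y \<in> D" for x y
    proof -
      have "Re (W x y * marginal D N \<Phi> x y) \<le> cmod (W x y) * cmod (marginal D N \<Phi> x y)"
        by (metis complex_Re_le_cmod norm_mult)
      also have "\<dots> \<le> cmod (W x y) * 1" using b[OF that] by (intro mult_left_mono) auto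
      finally show ?thesis by simp
    qed
    then have "mat_val D W (marginal D N \<Phi>) \<le> (\<Sum>x\<in>D. \<Sum>y\<in>D. cmod (W x y))"
      unfolding mat_val_def Re_sum by (intro sum_mono)
    moreover have "sq_norm_on D (marginal D N \<Phi>) \<le> (\<Sum>x\<in>D. \<Sum>y\<in>D. 1)"
      unfolding sq_norm_on_def by (intro sum_mono power_le_one b) auto
    ultimately show ?thesis unfolding H_def using t by (intro add_mono mult_left_mono) auto
  qed
  then have bdd: "bdd_above (V N)" for N unfolding V_def by (intro bdd_aboveI) blast
  have ne: "V N \<noteq> {}" for N using ex[of N] unfolding V_def by blast
  have Hle: "H (marginal D N \<Phi>) \<le> h N" if "ext_feasible D \<K> N \<Phi>" for N \<Phi>
    unfolding h_def by (rule cSup_upper[OF _ bdd]) (use that in \<open>auto simp: V_def\<close>)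
  have hc: "c \<le> h N" for N
  proof -
    obtain \<Phi> where \<Phi>: "ext_feasible D \<K> N \<Phi>" "c \<le> mat_val D W (marginal D N \<Phi>)" using ex by blast
    have "mat_val D W (marginal D N \<Phi>) \<le> H (marginal D N \<Phi>)"
      using t by (simp add: H_def sq_norm_on_nonneg)
    then show ?thesis using Hle[OF \<Phi>(1)] \<Phi>(2) by linarith
  qed
  let ?S = "D \<times> D \<times> polar_phases"
  define dev where "dev s N \<Phi> = sq_norm_on D (\<lambda>x y. marginal D N (condition_on D (polar_vec D s) \<Phi>) x y
         - (\<Sum>z\<in>D. marginal D N (condition_on D (polar_vec D s) \<Phi>) z z) * marginal D (Suc N) \<Phi> x y)" for s N \<Phi>
  have avg: "H (marginal D (Suc N) \<Phi>) + t * dev s N \<Phi> \<le> h N"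
    if "ext_feasible D \<K> (Suc N) \<Phi>" "s \<in> ?S" for N \<Phi> s
    unfolding H_def dev_def
    by (rule condition_average[OF D _ polar_vec_resolution[OF D] that(1) _ _ that(2)])
       (use D t Hle in \<open>auto simp: H_def\<close>)
  have "D \<noteq> {}" using ex[of 0] by (auto simp: ext_feasible_def)
  then obtain d0 where d0: "d0 \<in> D" by blast
  have dec: "h (Suc N) \<le> h N" for N
    unfolding h_def[of "Suc N"]
  proof (rule cSup_least[OF ne])
    fix y assume "y \<in> V (Suc N)"
    then obtain \<Phi> where \<Phi>: "ext_feasible D \<K> (Suc N) \<Phi>" "y = H (marginal D (Suc N) \<Phi>)"
      unfolding V_def by blast
    \<comment> \<open>Any outcome serves here, as only the sign of the deviation is used.\<close>
    have "0 \<le> t * dev (d0, d0, 1) N \<Phi>"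
      unfolding dev_def using t by (intro mult_nonneg_nonneg sq_norm_on_nonneg) simp
    moreover have "H (marginal D (Suc N) \<Phi>) + t * dev (d0, d0, 1) N \<Phi> \<le> h N"
      by (rule avg[OF \<Phi>(1)]) (use d0 in \<open>simp add: polar_phases_def\<close>)
    ultimately show "y \<le> h N" using \<Phi>(2) by linarith
  qed
  have "decseq h" using dec by (rule decseq_SucI)
  then obtain hl where hl: "h \<longlonglongrightarrow> hl" using decseq_convergent[of h c] hc by blast
  \<comment> \<open>A vanishing slack replaces attainment of the supremum.\<close>
  have "\<exists>\<Phi>. ext_feasible D \<K> (Suc N) \<Phi> \<and> h (Suc N) - 1 / real (Suc N) < H (marginal D (Suc N) \<Phi>)" for N
  proof -
    have "h (Suc N) - 1 / real (Suc N) < Sup (V (Suc N))" by (simp add: h_def)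
    then obtain y where "y \<in> V (Suc N)" "h (Suc N) - 1 / real (Suc N) < y"
      using less_cSup_iff[OF ne bdd] by blast
    then show ?thesis unfolding V_def by blast
  qed
  then obtain \<Phi> where \<Phi>: "\<And>N. ext_feasible D \<K> (Suc N) (\<Phi> N)"
    and \<Phi>H: "\<And>N. h (Suc N) - 1 / real (Suc N) < H (marginal D (Suc N) (\<Phi> N))" by metis
  have cone: "ext_cone D \<K> (Suc N) (\<Phi> N)" for N using \<Phi> by (simp add: ext_feasible_def)
  \<comment> \<open>The coordinates are finitely many, independently of N; one-party marginals then
    converge by partial trace.\<close>
  obtain r G where r: "strict_mono r"
    and G: "\<forall>i\<in>D \<times> D \<times> D \<times> D. (\<lambda>N. (\<lambda>(a, x, b, y). marginal2 D (r N) (\<Phi> (r N)) a x b y) i) \<longlonglongrightarrow> G i"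
    using finite_family_convergent_subseq[of "D \<times> D \<times> D \<times> D" "\<lambda>N (a, x, b, y). marginal2 D N (\<Phi> N) a x b y" 1]
      marginal2_bound[OF D \<Phi>] D by (auto simp: case_prod_unfold)
  define \<Omega> where "\<Omega> a x b y = G (a, x, b, y)" for a x b y
  define \<rho> where "\<rho> a b = (\<Sum>x\<in>D. \<Omega> a x b x)" for a b
  have \<Omega>: "(\<lambda>N. marginal2 D (r N) (\<Phi> (r N)) a x b y) \<longlonglongrightarrow> \<Omega> a x b y"
    if "a \<in> D" "x \<in> D" "b \<in> D" "y \<in> D" for a x b y
    using G that unfolding \<Omega>_def by fastforce
  have \<rho>: "(\<lambda>N. marginal D (Suc (r N)) (\<Phi> (r N)) a b) \<longlonglongrightarrow> \<rho> a b" if "a \<in> D" "b \<in> D" for a b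
    unfolding marginal_Suc(1)[OF cone that] \<rho>_def by (intro tendsto_sum \<Omega> that)
  have psd: "psd_on D \<rho>"
    by (rule psd_on_lim[OF psd_on_marginal[OF D cone] \<rho>])
  have tr: "(\<Sum>x\<in>D. \<rho> x x) = 1"
  proof (rule LIMSEQ_unique)
    show "(\<lambda>N. \<Sum>x\<in>D. marginal D (Suc (r N)) (\<Phi> (r N)) x x) \<longlonglongrightarrow> (\<Sum>x\<in>D. \<rho> x x)"
      by (intro tendsto_sum \<rho>)
    show "(\<lambda>N. \<Sum>x\<in>D. marginal D (Suc (r N)) (\<Phi> (r N)) x x) \<longlonglongrightarrow> 1"
      using \<Phi> by (simp add: ext_feasible_def)
  qed
  have constr: "(\<Sum>x\<in>D. \<Sum>y\<in>D. K x y * \<rho> x y) = 0" if "K \<in> \<K>" for K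
  proof (rule LIMSEQ_unique)
    show "(\<lambda>N. \<Sum>x\<in>D. \<Sum>y\<in>D. K x y * marginal D (Suc (r N)) (\<Phi> (r N)) x y) \<longlonglongrightarrow> (\<Sum>x\<in>D. \<Sum>y\<in>D. K x y * \<rho> x y)"
      by (intro tendsto_intros \<rho>)
    show "(\<lambda>N. \<Sum>x\<in>D. \<Sum>y\<in>D. K x y * marginal D (Suc (r N)) (\<Phi> (r N)) x y) \<longlonglongrightarrow> 0"
      unfolding marginal_constraint[OF cone that] by simp
  qed
  have swap: "\<Omega> a x b y = \<Omega> x a b y" if "a \<in> D" "x \<in> D" "b \<in> D" "y \<in> D" for a x b y
    by (rule LIMSEQ_unique[OF \<Omega>[OF that]])
       (use \<Omega>[of x a b y] marginal2_swap(1)[OF cone that] that in simp)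
  have Hlim: "(\<lambda>N. H (marginal D (Suc (r N)) (\<Phi> (r N)))) \<longlonglongrightarrow> H \<rho>"
    unfolding H_def mat_val_def sq_norm_on_def by (intro tendsto_intros \<rho>)
  have Hc: "c \<le> H \<rho>"
  proof -
    have "(\<lambda>N. H (marginal D (Suc (r N)) (\<Phi> (r N))) + 1 / real (Suc (r N))) \<longlonglongrightarrow> H \<rho> + 0"
      by (intro tendsto_add Hlim LIMSEQ_subseq_LIMSEQ[OF LIMSEQ_inverse_real_of_nat r, unfolded o_def inverse_eq_divide])
    moreover have "c \<le> H (marginal D (Suc (r N)) (\<Phi> (r N))) + 1 / real (Suc (r N))" for N
      using \<Phi>H[of "r N"] hc[of "Suc (r N)"] by linarith
    ultimately show ?thesis using LIMSEQ_le_const by fastforce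
  qed
  have dev0: "(\<lambda>N. dev s (r N) (\<Phi> (r N))) \<longlonglongrightarrow> 0" if s: "s \<in> ?S" for s
  proof (rule tendsto_sandwich)
    show "\<forall>\<^sub>F N in sequentially. 0 \<le> dev s (r N) (\<Phi> (r N))"
      by (simp add: dev_def sq_norm_on_nonneg)
    have "dev s N (\<Phi> N) \<le> (h N - h (Suc N) + 1 / real (Suc N)) / t" for N
    proof -
      have "t * dev s N (\<Phi> N) \<le> h N - h (Suc N) + 1 / real (Suc N)"
        using avg[OF \<Phi> s, of N] \<Phi>H[of N] by linarith
      then show ?thesis by (simp only: pos_le_divide_eq[OF t] mult.commute)
    qed
    then show "\<forall>\<^sub>F N in sequentially. dev s (r N) (\<Phi> (r N)) \<le> (h (r N) - h (Suc (r N)) + 1 / real (Suc (r N))) / t"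
      by simp
    have "(\<lambda>N. (h N - h (Suc N) + 1 / real (Suc N)) / t) \<longlonglongrightarrow> (hl - hl + 0) / t"
      by (intro tendsto_intros hl LIMSEQ_Suc[OF hl] LIMSEQ_inverse_real_of_nat[unfolded inverse_eq_divide]) (use t in auto)
    from LIMSEQ_subseq_LIMSEQ[OF this r]
    show "(\<lambda>N. (h (r N) - h (Suc (r N)) + 1 / real (Suc (r N))) / t) \<longlonglongrightarrow> 0"
      by (simp add: o_def)
  qed simp
  \<comment> \<open>Zero limiting deviation makes each conditional marginal its trace times
    \<open>\<rho>\<close>. The measurement determines the dependence on the first party, so the
    two-party limit factorises.\<close>
  have prod: "\<Omega> a x b y = \<rho> a b * \<rho> x y" if mem: "a \<in> D" "x \<in> D" "b \<in> D" "y \<in> D" for a x b y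
  proof -
    have "(\<Sum>a\<in>D. \<Sum>b\<in>D. cnj (polar_vec D s a) * (\<Omega> a x b y - \<rho> a b * \<rho> x y) * polar_vec D s b) = 0"
      if s: "s \<in> ?S" for s
    proof -
      define \<sigma> where "\<sigma> x y = (\<Sum>a\<in>D. \<Sum>b\<in>D. cnj (polar_vec D s a) * \<Omega> a x b y * polar_vec D s b)" for x y
      have \<sigma>: "(\<lambda>N. marginal D (r N) (condition_on D (polar_vec D s) (\<Phi> (r N))) x y) \<longlonglongrightarrow> \<sigma> x y"
        if "x \<in> D" "y \<in> D" for x y
        unfolding marginal_condition \<sigma>_def by (intro tendsto_intros \<Omega> that)
      have "(\<lambda>N. dev s (r N) (\<Phi> (r N))) \<longlonglongrightarrow> sq_norm_on D (\<lambda>x y. \<sigma> x y - (\<Sum>z\<in>D. \<sigma> z z) * \<rho> x y)"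
        unfolding dev_def sq_norm_on_def by (intro tendsto_intros \<sigma> \<rho>)
      then have "sq_norm_on D (\<lambda>x y. \<sigma> x y - (\<Sum>z\<in>D. \<sigma> z z) * \<rho> x y) = 0"
        using LIMSEQ_unique[OF _ dev0[OF s]] by blast
      then have "\<sigma> x y - (\<Sum>z\<in>D. \<sigma> z z) * \<rho> x y = 0"
        by (rule sq_norm_on_eq_0D[OF D _ mem(2,4)])
      moreover have "(\<Sum>z\<in>D. \<sigma> z z) = (\<Sum>a\<in>D. \<Sum>b\<in>D. cnj (polar_vec D s a) * \<rho> a b * polar_vec D s b)"
      proof -
        have "(\<Sum>z\<in>D. \<sigma> z z) = (\<Sum>a\<in>D. \<Sum>z\<in>D. \<Sum>b\<in>D. cnj (polar_vec D s a) * \<Omega> a z b z * polar_vec D s b)"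
          unfolding \<sigma>_def by (rule sum.swap)
        also have "\<dots> = (\<Sum>a\<in>D. \<Sum>b\<in>D. \<Sum>z\<in>D. cnj (polar_vec D s a) * \<Omega> a z b z * polar_vec D s b)"
          by (rule sum.cong[OF refl], rule sum.swap)
        finally show ?thesis by (simp add: \<rho>_def sum_distrib_left sum_distrib_right)
      qed
      ultimately have "\<sigma> x y - (\<Sum>a\<in>D. \<Sum>b\<in>D. cnj (polar_vec D s a) * \<rho> a b * polar_vec D s b) * \<rho> x y = 0" by simp
      then show ?thesis
        unfolding \<sigma>_def sum_distrib_right sum_subtractf[symmetric]
        by (simp add: algebra_simps)
    qed
    from polar_vec_separates[OF D mem(1,3), of "\<lambda>a b. \<Omega> a x b y - \<rho> a b * \<rho> x y", OF this]
    show ?thesis by simp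
  qed
  \<comment> \<open>Exchanging row letters in the product form yields the vanishing minors.\<close>
  have "\<rho> a b * \<rho> x y = \<rho> x b * \<rho> a y" if "a \<in> D" "b \<in> D" "x \<in> D" "y \<in> D" for a b x y
    using swap[of a x b y] prod[of a x b y] prod[of x a b y] that by simp
  then obtain \<psi> where \<psi>: "\<And>x y. x \<in> D \<Longrightarrow> y \<in> D \<Longrightarrow> \<rho> x y = \<psi> x * cnj (\<psi> y)"
    using psd_on_pure[OF D psd] tr by (metis zero_neq_one)
  have tr': "(\<Sum>x\<in>D. \<psi> x * cnj (\<psi> x)) = 1" using tr \<psi> by simp
  have "(\<Sum>x\<in>D. (cmod (\<psi> x))\<^sup>2) = 1"
  proof -
    have "complex_of_real (\<Sum>x\<in>D. (cmod (\<psi> x))\<^sup>2) = 1"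
      unfolding of_real_sum complex_norm_square by (rule tr')
    then show ?thesis using of_real_eq_1_iff by blast
  qed
  then have "sq_norm_on D (\<lambda>x y. \<psi> x * cnj (\<psi> y)) = 1"
    by (simp add: sq_norm_on_def norm_mult power_mult_distrib sum_distrib_left[symmetric])
  moreover have "H \<rho> = H (\<lambda>x y. \<psi> x * cnj (\<psi> y))"
    unfolding H_def mat_val_def sq_norm_on_def using \<psi> by simp
  ultimately have "c - t \<le> mat_val D W (\<lambda>x y. \<psi> x * cnj (\<psi> y))"
    using Hc by (simp add: H_def)
  moreover have "(\<Sum>x\<in>D. \<Sum>y\<in>D. K x y * (\<psi> x * cnj (\<psi> y))) = 0" if "K \<in> \<K>" for K
    using constr[OF that] \<psi> by simp
  ultimately show ?thesis using tr' by blast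
qed

section \<open>The hierarchy\<close>

text \<open>The tensor power of the rank-one operator of \<open>\<psi>\<close>. The exponent is the
  word length, so one function serves all levels.\<close>

definition tensor_power :: "('a \<Rightarrow> complex) \<Rightarrow> 'a list \<Rightarrow> 'a list \<Rightarrow> complex" where
  "tensor_power \<psi> xs ys = prod_list (map \<psi> xs) * cnj (prod_list (map \<psi> ys))"

lemma tensor_power_Cons:
  "tensor_power \<psi> (x # xs) (y # ys) = \<psi> x * cnj (\<psi> y) * tensor_power \<psi> xs ys"
  by (simp add: tensor_power_def)

lemma sum_tensor_power_diag:
  "(\<Sum>xs\<in>words D N. tensor_power \<psi> xs xs) = (\<Sum>x\<in>D. \<psi> x * cnj (\<psi> x)) ^ N"
proof -
  have "tensor_power \<psi> xs xs = prod_list (map (\<lambda>x. \<psi> x * cnj (\<psi> x)) xs)" for xs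
    by (induction xs) (simp_all add: tensor_power_def mult_ac)
  then show ?thesis by (simp add: sum_words_prod_list)
qed

lemma marginal_tensor_power:
  assumes "(\<Sum>x\<in>D. \<psi> x * cnj (\<psi> x)) = 1"
  shows "marginal D N (tensor_power \<psi>) x y = \<psi> x * cnj (\<psi> y)"
  using assms by (simp add: marginal_def tensor_power_Cons sum_distrib_left[symmetric] sum_tensor_power_diag)

lemma ext_feasible_tensor_power:
  assumes tr: "(\<Sum>x\<in>D. \<psi> x * cnj (\<psi> x)) = 1"
    and K: "\<And>K. K \<in> \<K> \<Longrightarrow> (\<Sum>x\<in>D. \<Sum>y\<in>D. K x y * (\<psi> x * cnj (\<psi> y))) = 0"
  shows "ext_feasible D \<K> N (tensor_power \<psi>)"
proof -
  have "psd_on (words D (Suc N)) (tensor_power \<psi>)"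
    unfolding tensor_power_def by (rule psd_on_outer)
  moreover have "word_sym D (Suc N) (tensor_power \<psi>)"
    unfolding word_sym_def tensor_power_def by (metis mset_map prod_mset_prod_list)
  moreover have "(\<Sum>x\<in>D. \<Sum>y\<in>D. K x y * tensor_power \<psi> (x # xs) (y # ys)) = 0" if "K \<in> \<K>" for K xs ys
  proof -
    have "(\<Sum>x\<in>D. \<Sum>y\<in>D. K x y * tensor_power \<psi> (x # xs) (y # ys))
       = (\<Sum>x\<in>D. \<Sum>y\<in>D. K x y * (\<psi> x * cnj (\<psi> y))) * tensor_power \<psi> xs ys"
      unfolding tensor_power_Cons sum_distrib_right by (simp add: mult_ac)
    then show ?thesis using K[OF that] by simp
  qed
  ultimately show ?thesis
    unfolding ext_feasible_def ext_cone_def by (simp add: marginal_tensor_power[OF tr] tr)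
qed

section \<open>Convergence of the optimal values\<close>

definition pure_opt :: "'a set \<Rightarrow> ('a \<Rightarrow> 'a \<Rightarrow> complex) set \<Rightarrow> ('a \<Rightarrow> 'a \<Rightarrow> complex) \<Rightarrow> ereal" where
  "pure_opt D \<K> W = Sup {ereal (mat_val D W (\<lambda>x y. \<psi> x * cnj (\<psi> y))) | \<psi>.
     (\<Sum>x\<in>D. \<psi> x * cnj (\<psi> x)) = 1 \<and> (\<forall>K\<in>\<K>. (\<Sum>x\<in>D. \<Sum>y\<in>D. K x y * (\<psi> x * cnj (\<psi> y))) = 0)}"

definition ext_opt :: "'a set \<Rightarrow> ('a \<Rightarrow> 'a \<Rightarrow> complex) set \<Rightarrow> ('a \<Rightarrow> 'a \<Rightarrow> complex) \<Rightarrow> nat \<Rightarrow> ereal" where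
  "ext_opt D \<K> W N = Sup {ereal (mat_val D W (marginal D N \<Phi>)) | \<Phi>. ext_feasible D \<K> N \<Phi>}"

lemma pure_opt_le_ext_opt: "pure_opt D \<K> W \<le> ext_opt D \<K> W N"
  unfolding pure_opt_def
proof (rule Sup_least, clarify)
  fix \<psi> assume *: "(\<Sum>x\<in>D. \<psi> x * cnj (\<psi> x)) = 1" "\<forall>K\<in>\<K>. (\<Sum>x\<in>D. \<Sum>y\<in>D. K x y * (\<psi> x * cnj (\<psi> y))) = 0"
  have "ext_feasible D \<K> N (tensor_power \<psi>)" using ext_feasible_tensor_power[OF *(1)] *(2) by blast
  moreover have "marginal D N (tensor_power \<psi>) = (\<lambda>x y. \<psi> x * cnj (\<psi> y))"
    by (intro ext marginal_tensor_power[OF *(1)])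
  ultimately show "ereal (mat_val D W (\<lambda>x y. \<psi> x * cnj (\<psi> y))) \<le> ext_opt D \<K> W N"
    unfolding ext_opt_def by (intro Sup_upper) force
qed

lemma ext_opt_Suc_le:
  assumes D: "finite D"
  shows "ext_opt D \<K> W (Suc N) \<le> ext_opt D \<K> W N"
proof (rule ereal_le_real)
  \<comment> \<open>Comparing real upper bounds also covers infeasible levels, whose value is minus
    infinity.\<close>
  fix z assume z: "ext_opt D \<K> W N \<le> ereal z"
  have bound: "mat_val D W (marginal D N \<Psi>) + 0 * sq_norm_on D (marginal D N \<Psi>) \<le> z"
    if "ext_feasible D \<K> N \<Psi>" for \<Psi>
  proof -
    have "ereal (mat_val D W (marginal D N \<Psi>)) \<le> ext_opt D \<K> W N"
      unfolding ext_opt_def using that by (intro Sup_upper) blast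
    then show ?thesis using z by (metis add.right_neutral ereal_less_eq(3) mult_zero_left order_trans)
  qed
  show "ext_opt D \<K> W (Suc N) \<le> ereal z"
    unfolding ext_opt_def
  proof (rule Sup_least, clarify)
    fix \<Phi> assume \<Phi>: "ext_feasible D \<K> (Suc N) \<Phi>"
    then obtain d where d: "d \<in> D" unfolding ext_feasible_def by fastforce
    \<comment> \<open>Measurement in the standard basis; with \<open>t = 0\<close> no informational
      completeness is required.\<close>
    have res: "(\<Sum>s\<in>D. cnj (of_bool (a = s)) * of_bool (b = s)) = (if a = b then 1 else 0 :: complex)"
      if "a \<in> D" "b \<in> D" for a b
    proof -
      have "(\<Sum>s\<in>D. cnj (of_bool (a = s)) * of_bool (b = s)) = (\<Sum>s\<in>D. if a = s then if a = b then 1 else 0 else 0 :: complex)"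
        by (rule sum.cong) auto
      then show ?thesis using D that by simp
    qed
    show "ereal (mat_val D W (marginal D (Suc N) \<Phi>)) \<le> ereal z"
      using condition_average[where v = "\<lambda>s a. of_bool (a = s)" and W = W and h = z and t = 0, OF D D res \<Phi> bound _ d]
      by simp
  qed
qed

text \<open>If the infimum exceeded the pure optimum, two reals \<open>c < c'\<close> would fit
  between them. Every level reaches \<open>c'\<close>, and the allowed loss \<open>c' - c\<close>
  yields a pure state of value at least \<open>c\<close>. This includes an infeasible pure
  problem.\<close>

theorem ext_opt_tendsto_pure_opt:
  assumes D: "finite D"
  shows "ext_opt D \<K> W \<longlonglongrightarrow> pure_opt D \<K> W"
proof -
  have "decseq (ext_opt D \<K> W)" by (intro decseq_SucI ext_opt_Suc_le D)
  then have lim: "ext_opt D \<K> W \<longlonglongrightarrow> (INF N. ext_opt D \<K> W N)" by (rule LIMSEQ_INF)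
  have "(INF N. ext_opt D \<K> W N) \<le> pure_opt D \<K> W"
  proof (rule ccontr)
    assume "\<not> ?thesis"
    then obtain c where c: "pure_opt D \<K> W < ereal c" "ereal c < (INF N. ext_opt D \<K> W N)"
      using ereal_dense2[of "pure_opt D \<K> W"] by (auto simp: not_le)
    obtain c' where c': "ereal c < ereal c'" "ereal c' < (INF N. ext_opt D \<K> W N)"
      using ereal_dense2[OF c(2)] by blast
    have "\<exists>\<Phi>. ext_feasible D \<K> N \<Phi> \<and> c' \<le> mat_val D W (marginal D N \<Phi>)" for N
    proof -
      have "ereal c' < ext_opt D \<K> W N" using c'(2) by (meson INF_lower UNIV_I less_le_trans)
      then show ?thesis unfolding ext_opt_def less_Sup_iff by (auto simp: less_imp_le)
    qed
    from extendible_limit_pure[OF D _ this, of "c' - c"] c'(1)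
    obtain \<psi> where "(\<Sum>x\<in>D. \<psi> x * cnj (\<psi> x)) = 1"
      "\<forall>K\<in>\<K>. (\<Sum>x\<in>D. \<Sum>y\<in>D. K x y * (\<psi> x * cnj (\<psi> y))) = 0"
      "c \<le> mat_val D W (\<lambda>x y. \<psi> x * cnj (\<psi> y))" by auto
    then have "ereal c \<le> pure_opt D \<K> W"
      unfolding pure_opt_def by (intro Sup_upper2[of "ereal (mat_val D W (\<lambda>x y. \<psi> x * cnj (\<psi> y)))"]) auto
    with c(1) show False by simp
  qed
  moreover have "pure_opt D \<K> W \<le> (INF N. ext_opt D \<K> W N)"
    by (intro INF_greatest pure_opt_le_ext_opt)
  ultimately have "(INF N. ext_opt D \<K> W N) = pure_opt D \<K> W" by (rule antisym)
  with lim show ?thesis by simp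
qed

section \<open>Translation of matrices, partial traces and linear maps into coordinates\<close>

definition mat_unit :: "nat \<Rightarrow> nat \<Rightarrow> nat \<Rightarrow> complex mat" where
  "mat_unit n i j = mat n n (\<lambda>(a, b). if a = i \<and> b = j then 1 else 0)"

lemma linear_map_mat_entry:
  assumes L: "linear_map_mat n m L" and pq: "p < m" "q < m"
  shows "L (mat n n (\<lambda>(i,j). f i j)) $$ (p,q) = (\<Sum>i<n. \<Sum>j<n. L (mat_unit n i j) $$ (p,q) * f i j)"
proof -
  have carr: "L A \<in> carrier_mat m m" if "A \<in> carrier_mat n n" for A
    using L that by (simp add: linear_map_mat_def)
  have add: "L (A + B) = L A + L B" if "A \<in> carrier_mat n n" "B \<in> carrier_mat n n" for A B
    using L that by (simp add: linear_map_mat_def)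
  have smult: "L (c \<cdot>\<^sub>m A) = c \<cdot>\<^sub>m L A" if "A \<in> carrier_mat n n" for A c
    using L that by (simp add: linear_map_mat_def)
  define M where "M S = mat n n (\<lambda>(i,j). if (i,j) \<in> S then f i j else 0)" for S
  have Mc: "M S \<in> carrier_mat n n" for S by (simp add: M_def)
  have uc: "mat_unit n i j \<in> carrier_mat n n" for i j by (simp add: mat_unit_def)
  have "L (M S) $$ (p,q) = (\<Sum>(i,j)\<in>S. L (mat_unit n i j) $$ (p,q) * f i j)" if "finite S" for S
    using that
  proof (induction S rule: finite_induct)
    case empty
    \<comment> \<open>That \<open>L\<close> maps zero to zero follows from homogeneity with scalar
      0.\<close>
    have "M {} = 0 \<cdot>\<^sub>m M {}" by (rule eq_matI) (auto simp: M_def)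
    then have "L (M {}) = 0 \<cdot>\<^sub>m L (M {})" using smult[OF Mc] by metis
    then have "L (M {}) $$ (p,q) = (0 \<cdot>\<^sub>m L (M {})) $$ (p,q)" by simp
    then show ?case using carr[OF Mc, of "{}"] pq by simp
  next
    case (insert x S)
    obtain i j where x: "x = (i, j)" by force
    have "M (insert x S) = M S + f i j \<cdot>\<^sub>m mat_unit n i j"
      by (rule eq_matI) (use insert.hyps x in \<open>auto simp: M_def mat_unit_def\<close>)
    then have "L (M (insert x S)) = L (M S) + f i j \<cdot>\<^sub>m L (mat_unit n i j)"
      using add[OF Mc smult_carrier_mat[OF uc]] smult[OF uc] by simp
    then show ?case
      using carr[OF Mc, of S] carr[OF uc, of i j] pq insert by (simp add: x add.commute)
  qed
  from this[of "{..<n} \<times> {..<n}"]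
  have "L (M ({..<n} \<times> {..<n})) $$ (p,q) = (\<Sum>i<n. \<Sum>j<n. L (mat_unit n i j) $$ (p,q) * f i j)"
    by (simp add: sum.cartesian_product)
  moreover have "M ({..<n} \<times> {..<n}) = mat n n (\<lambda>(i,j). f i j)"
    by (rule eq_matI) (auto simp: M_def)
  ultimately show ?thesis by simp
qed

text \<open>The functional with coefficients \<open>g\<close>, composed with the partial trace over
  C^k: the identity pattern on the second factor.\<close>

definition lift_coeff :: "(nat \<Rightarrow> nat \<Rightarrow> complex) \<Rightarrow> nat \<times> nat \<Rightarrow> nat \<times> nat \<Rightarrow> complex" where
  "lift_coeff g x y = (if snd x = snd y then g (fst x) (fst y) else 0)"

lemma sum_party_idx: "(\<Sum>x\<in>party_idx n k. f x) = (\<Sum>i<n. \<Sum>a<k. f (i, a))"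
  by (simp add: party_idx_eq sum.cartesian_product)

lemma sum_lift_coeff:
  "(\<Sum>x\<in>party_idx n k. \<Sum>y\<in>party_idx n k. lift_coeff g x y * M x y)
     = (\<Sum>i<n. \<Sum>j<n. g i j * (\<Sum>a<k. M (i, a) (j, a)))"
proof -
  have "(\<Sum>x\<in>party_idx n k. \<Sum>y\<in>party_idx n k. lift_coeff g x y * M x y)
      = (\<Sum>i<n. \<Sum>a<k. \<Sum>j<n. \<Sum>b<k. if a = b then g i j * M (i, a) (j, b) else 0)"
    unfolding sum_party_idx by (intro sum.cong refl) (simp add: lift_coeff_def)
  also have "\<dots> = (\<Sum>i<n. \<Sum>a<k. \<Sum>j<n. g i j * M (i, a) (j, a))"
    by (intro sum.cong refl) simp
  also have "\<dots> = (\<Sum>i<n. \<Sum>j<n. \<Sum>a<k. g i j * M (i, a) (j, a))"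
    by (rule sum.cong[OF refl], rule sum.swap)
  finally show ?thesis by (simp add: sum_distrib_left)
qed

lemma linear_map_ptrace_2:
  assumes "linear_map_mat n m L" "p < m" "q < m"
  shows "L (ptrace_2 n k M) $$ (p,q) = (\<Sum>x\<in>party_idx n k. \<Sum>y\<in>party_idx n k.
     lift_coeff (\<lambda>i j. L (mat_unit n i j) $$ (p,q)) x y * M x y)"
  unfolding sum_lift_coeff ptrace_2_def by (rule linear_map_mat_entry[OF assms])

text \<open>\<open>mat_val\<close> pairs entries without transposing, so the trace of a product
  brings in the transpose of \<open>X\<close>.\<close>

lemma mtrace_mult_ptrace_2:
  assumes "X \<in> carrier_mat n n"
  shows "mtrace (X * ptrace_2 n k M)
    = (\<Sum>x\<in>party_idx n k. \<Sum>y\<in>party_idx n k. lift_coeff (\<lambda>i j. X $$ (j,i)) x y * M x y)"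
proof -
  have "mtrace (X * ptrace_2 n k M) = (\<Sum>i<n. \<Sum>j<n. X $$ (i,j) * (\<Sum>a<k. M (j, a) (i, a)))"
    using assms unfolding mtrace_def ptrace_2_def
    by (auto simp: scalar_prod_def atLeast0LessThan intro!: sum.cong)
  also have "\<dots> = (\<Sum>j<n. \<Sum>i<n. X $$ (i,j) * (\<Sum>a<k. M (j, a) (i, a)))"
    by (rule sum.swap)
  finally show ?thesis by (simp add: sum_lift_coeff)
qed

lemma mtrace_ptrace_2: "mtrace (ptrace_2 n k M) = (\<Sum>x\<in>party_idx n k. M x x)"
  by (simp add: mtrace_def ptrace_2_def sum_party_idx)

text \<open>The coefficient matrix for (p,q) is that of the (p,q) entry of Lambda~(M) - Tr(M) Y.\<close>

definition constr_set :: "nat \<Rightarrow> nat \<Rightarrow> (complex mat \<Rightarrow> complex mat) \<Rightarrow> complex mat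
    \<Rightarrow> (nat \<times> nat \<Rightarrow> nat \<times> nat \<Rightarrow> complex) set" where
  "constr_set n m L Y = (\<lambda>(p, q) x y. lift_coeff (\<lambda>i j. L (mat_unit n i j) $$ (p,q)) x y
      - (if x = y then Y $$ (p,q) else 0)) ` ({..<m} \<times> {..<m})"

text \<open>The trace factor makes the constraint homogeneous. With \<open>M\<close> a slice of
  \<open>\<Phi>\<close> it is the lifted constraint, with \<open>M\<close> of trace one it is the
  original one.\<close>

lemma constr_set_iff:
  assumes L: "linear_map_mat n m L"
  shows "(\<forall>K\<in>constr_set n m L Y. (\<Sum>x\<in>party_idx n k. \<Sum>y\<in>party_idx n k. K x y * M x y) = 0)
    \<longleftrightarrow> (\<forall>p<m. \<forall>q<m. L (ptrace_2 n k M) $$ (p,q) = Y $$ (p,q) * (\<Sum>x\<in>party_idx n k. M x x))"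
proof -
  have "(\<Sum>x\<in>party_idx n k. \<Sum>y\<in>party_idx n k.
      (lift_coeff (\<lambda>i j. L (mat_unit n i j) $$ (p,q)) x y - (if x = y then Y $$ (p,q) else 0)) * M x y)
     = L (ptrace_2 n k M) $$ (p,q) - Y $$ (p,q) * (\<Sum>x\<in>party_idx n k. M x x)" if "p < m" "q < m" for p q
    unfolding linear_map_ptrace_2[OF L that]
    by (simp add: left_diff_distrib sum_subtractf if_distrib[of "\<lambda>z. z * _"] sum_distrib_left cong: if_cong)
  then show ?thesis unfolding constr_set_def by auto
qed

lemma feasible_N_iff:
  assumes L: "linear_map_mat n m L"
  shows "feasible_N n m k (Suc N) L Y \<Phi> \<longleftrightarrow> ext_feasible (party_idx n k) (constr_set n m L Y) N \<Phi>"
proof -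
  let ?D = "party_idx n k"
  have "(\<forall>p<m. \<forall>q<m. \<forall>xs\<in>words ?D N. \<forall>ys\<in>words ?D N.
        lift_map n k L \<Phi> p xs q ys = Y $$ (p,q) * ptrace_A n k \<Phi> xs ys)
     \<longleftrightarrow> (\<forall>xs\<in>words ?D N. \<forall>ys\<in>words ?D N. \<forall>K\<in>constr_set n m L Y.
        (\<Sum>x\<in>?D. \<Sum>y\<in>?D. K x y * \<Phi> (x # xs) (y # ys)) = 0)"
    unfolding constr_set_iff[OF L, where M = "\<lambda>x y. \<Phi> (x # _) (y # _)"] lift_map_def ptrace_A_def by blast
  then show ?thesis
    unfolding feasible_N_def sym_proj_invariant_iff_word_sym
    unfolding ext_feasible_def ext_cone_def op_psd_iff_psd_on op_trace_def multi_idx_eq_words sum_words_Suc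
      marginal_def diff_Suc_1 by blast
qed

lemma obj_N_eq:
  assumes "X \<in> carrier_mat n n"
  shows "Re (obj_N n k (Suc N) X \<Phi>) = mat_val (party_idx n k) (lift_coeff (\<lambda>i j. X $$ (j,i))) (marginal (party_idx n k) N \<Phi>)"
proof -
  have "(\<Sum>x\<in>party_idx n k. \<Sum>y\<in>party_idx n k. lift_coeff (\<lambda>i j. X $$ (j,i)) x y * marginal (party_idx n k) N \<Phi> x y)
     = (\<Sum>j<n. \<Sum>i<n. \<Sum>a<k. \<Sum>xs\<in>words (party_idx n k) N. X $$ (i,j) * \<Phi> ((j,a) # xs) ((i,a) # xs))"
    unfolding sum_lift_coeff by (simp add: marginal_def sum_distrib_left)
  also have "\<dots> = (\<Sum>i<n. \<Sum>j<n. \<Sum>a<k. \<Sum>xs\<in>words (party_idx n k) N. X $$ (i,j) * \<Phi> ((j,a) # xs) ((i,a) # xs))"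
    by (rule sum.swap)
  also have "\<dots> = (\<Sum>i<n. \<Sum>j<n. \<Sum>xs\<in>words (party_idx n k) N. \<Sum>a<k. X $$ (i,j) * \<Phi> ((j,a) # xs) ((i,a) # xs))"
    by (rule sum.cong[OF refl], rule sum.cong[OF refl], rule sum.swap)
  also have "\<dots> = (\<Sum>i<n. \<Sum>xs\<in>words (party_idx n k) N. \<Sum>j<n. \<Sum>a<k. X $$ (i,j) * \<Phi> ((j,a) # xs) ((i,a) # xs))"
    by (rule sum.cong[OF refl], rule sum.swap)
  also have "\<dots> = (\<Sum>xs\<in>words (party_idx n k) N. \<Sum>i<n. \<Sum>j<n. \<Sum>a<k. X $$ (i,j) * \<Phi> ((j,a) # xs) ((i,a) # xs))"
    by (rule sum.swap)
  finally show ?thesis unfolding mat_val_def obj_N_def multi_idx_eq_words by (simp only: diff_Suc_1)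
qed

lemma xi_N_eq_ext_opt:
  assumes "X \<in> carrier_mat n n" "linear_map_mat n m L"
  shows "xi_N n m k X L Y (Suc N)
    = ext_opt (party_idx n k) (constr_set n m L Y) (lift_coeff (\<lambda>i j. X $$ (j,i))) N"
  unfolding xi_N_def ext_opt_def obj_N_eq[OF assms(1)] feasible_N_iff[OF assms(2)] ..

lemma psd_mat_ptrace_2_outer: "psd_mat n (ptrace_2 n k (\<lambda>x y. \<psi> x * cnj (\<psi> y)))"
proof -
  let ?f = "\<lambda>i j. \<Sum>a<k. \<psi> (i, a) * cnj (\<psi> (j, a))"
  have "psd_on {..<n} ?f" by (rule psd_on_sum, rule psd_on_outer)
  moreover have "psd_on {..<n} (\<lambda>i j. ptrace_2 n k (\<lambda>x y. \<psi> x * cnj (\<psi> y)) $$ (i,j)) = psd_on {..<n} ?f"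
    by (rule psd_on_cong) (simp add: ptrace_2_def)
  ultimately show ?thesis by (simp add: psd_mat_iff_psd_on ptrace_2_def)
qed

text \<open>Purification: the \<open>k\<close> Gram vectors are the components of
  \<open>\<psi>\<close> along a basis of the ancilla.\<close>

lemma rank_constrained_iff_purification:
  "\<rho> \<in> carrier_mat n n \<and> psd_mat n \<rho> \<and> mat_rank n \<rho> \<le> k
     \<longleftrightarrow> (\<exists>\<psi>. \<rho> = ptrace_2 n k (\<lambda>x y. \<psi> x * cnj (\<psi> y)))"
proof safe
  assume "\<rho> \<in> carrier_mat n n" "psd_mat n \<rho>" "mat_rank n \<rho> \<le> k"
  then obtain b where "\<forall>i<n. \<forall>j<n. \<rho> $$ (i,j) = (\<Sum>s<k. b s i * cnj (b s j))"
    using psd_rank_gram by blast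
  then have "\<rho> = ptrace_2 n k (\<lambda>x y. (\<lambda>(i, a). b a i) x * cnj ((\<lambda>(i, a). b a i) y))"
    using \<open>\<rho> \<in> carrier_mat n n\<close> by (intro eq_matI) (auto simp: ptrace_2_def)
  then show "\<exists>\<psi>. \<rho> = ptrace_2 n k (\<lambda>x y. \<psi> x * cnj (\<psi> y))"
    by (rule exI[of _ "\<lambda>(i, a). b a i"])
next
  fix \<psi> :: "nat \<times> nat \<Rightarrow> complex"
  show "ptrace_2 n k (\<lambda>x y. \<psi> x * cnj (\<psi> y)) \<in> carrier_mat n n" by (simp add: ptrace_2_def)
  show "psd_mat n (ptrace_2 n k (\<lambda>x y. \<psi> x * cnj (\<psi> y)))" by (rule psd_mat_ptrace_2_outer)
  show "mat_rank n (ptrace_2 n k (\<lambda>x y. \<psi> x * cnj (\<psi> y))) \<le> k"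
    unfolding ptrace_2_def by (rule mat_rank_sum_le)
qed

lemma xi_opt_eq_pure_opt:
  assumes X: "X \<in> carrier_mat n n" and L: "linear_map_mat n m L" and Y: "Y \<in> carrier_mat m m"
  shows "xi_opt n m k X L Y
    = pure_opt (party_idx n k) (constr_set n m L Y) (lift_coeff (\<lambda>i j. X $$ (j,i)))"
proof -
  let ?R = "\<lambda>\<psi>. ptrace_2 n k (\<lambda>x y. \<psi> x * cnj (\<psi> y))"
  have feas: "L (?R \<psi>) = Y \<and> mtrace (?R \<psi>) = 1 \<longleftrightarrow>
     (\<Sum>x\<in>party_idx n k. \<psi> x * cnj (\<psi> x)) = 1 \<and> (\<forall>K\<in>constr_set n m L Y.
        (\<Sum>x\<in>party_idx n k. \<Sum>y\<in>party_idx n k. K x y * (\<psi> x * cnj (\<psi> y))) = 0)" for \<psi>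
  proof -
    have "L (?R \<psi>) \<in> carrier_mat m m"
      using L by (simp add: linear_map_mat_def ptrace_2_def)
    then have "L (?R \<psi>) = Y \<longleftrightarrow> (\<forall>p<m. \<forall>q<m. L (?R \<psi>) $$ (p,q) = Y $$ (p,q))"
      using Y by (auto intro!: eq_matI)
    then show ?thesis
      unfolding constr_set_iff[OF L] mtrace_ptrace_2 by auto
  qed
  have "\<rho> \<in> carrier_mat n n \<and> L \<rho> = Y \<and> mtrace \<rho> = 1 \<and> psd_mat n \<rho> \<and> mat_rank n \<rho> \<le> k
      \<longleftrightarrow> (\<exists>\<psi>. \<rho> = ?R \<psi>) \<and> L \<rho> = Y \<and> mtrace \<rho> = 1" for \<rho>
    unfolding rank_constrained_iff_purification[of \<rho> n k, symmetric] by (rule iffI) simp_all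
  then have "{ereal (Re (mtrace (X * \<rho>))) | \<rho>. \<rho> \<in> carrier_mat n n \<and> L \<rho> = Y \<and> mtrace \<rho> = 1 \<and> psd_mat n \<rho> \<and> mat_rank n \<rho> \<le> k}
      = {ereal (Re (mtrace (X * ?R \<psi>))) | \<psi>. L (?R \<psi>) = Y \<and> mtrace (?R \<psi>) = 1}"
    by (simp only:) blast
  then show ?thesis
    unfolding xi_opt_def pure_opt_def feas mtrace_mult_ptrace_2[OF X] mat_val_def by simp
qed

theorem theorem2:
  fixes n m k :: nat and X Y :: "complex mat" and L :: "complex mat \<Rightarrow> complex mat"
  assumes "0 < n" "0 < m" "0 < k"
    and "hermitian_mat n X"
    and "linear_map_mat n m L"
    and "Y \<in> carrier_mat m m"
  shows "(\<forall>N\<ge>1. xi_opt n m k X L Y \<le> xi_N n m k X L Y N)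
       \<and> (\<forall>N\<ge>1. xi_N n m k X L Y (N + 1) \<le> xi_N n m k X L Y N)
       \<and> (xi_N n m k X L Y \<longlonglongrightarrow> xi_opt n m k X L Y)"
proof -
  have X: "X \<in> carrier_mat n n" using assms(4) by (simp add: hermitian_mat_def)
  note eqs = xi_N_eq_ext_opt[OF X assms(5)] xi_opt_eq_pure_opt[OF X assms(5,6)]
  show ?thesis
  proof (intro conjI allI impI)
    fix N :: nat assume "N \<ge> 1"
    \<comment> \<open>\<open>ext_opt\<close> counts the parties besides the first, hence the shift
      by one.\<close>
    then obtain M where M: "N = Suc M" by (cases N) auto
    show "xi_opt n m k X L Y \<le> xi_N n m k X L Y N"
      unfolding M eqs by (rule pure_opt_le_ext_opt)
    show "xi_N n m k X L Y (N + 1) \<le> xi_N n m k X L Y N"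
      unfolding M Suc_eq_plus1[symmetric] eqs by (rule ext_opt_Suc_le[OF finite_party_idx])
  next
    \<comment> \<open>The shifted sequence leaves out the value at N = 0, which does not affect the
      limit.\<close>
    have "(\<lambda>N. xi_N n m k X L Y (Suc N)) \<longlonglongrightarrow> xi_opt n m k X L Y"
      unfolding eqs by (rule ext_opt_tendsto_pure_opt[OF finite_party_idx])
    then show "xi_N n m k X L Y \<longlonglongrightarrow> xi_opt n m k X L Y" by (rule LIMSEQ_imp_Suc)
  qed
qed

end
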